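(* Let $m,n\ge1$, $N=m+n$, and let $k$ be a positive odd integer. For every $f\in\mathcal{D}(\mathbb{R}^{m+n})$ the following identity holds (in the sense of distributions on $\mathbb{R}^m\times\mathbb{R}^n$): $$f(x,y)=\sum_{|\beta|+2|\gamma|\le k}\frac{(-1)^{|\beta|+|\gamma|}}{\beta!\,\gamma!}\Big(\int_{\mathbb{R}^N}f(x,y)x^\beta y^\gamma\,dx\,dy\Big)D_x^\beta D_y^\gamma\delta_0+\sum_{|\gamma|\le\frac{k-1}{2}}\ \sum_{|\beta|+2|\gamma|=k+1}\frac{(-1)^{|\gamma|}}{\gamma!}D_x^\beta[\mathcal{R}f]_{\beta\gamma}(x)\,D_y^\gamma\delta_0(y)+\sum_{|\gamma|=\frac{k+1}{2}}D_y^\gamma F_\gamma(x,y),$$ where, for $|\gamma|=\frac{k+1}{2}$, $$F_\gamma(x,y)=\frac{k+1}{2}\,\frac{(-1)^{\frac{k+1}{2}}}{\gamma!}\int_0^1(1-t)^{\frac{k-1}{2}}\Big(\frac yt\Big)^{\gamma}f\Big(x,\frac yt\Big)\frac{dt}{t^n},$$ and, for $|\gamma|\le\frac{k-1}{2}$ and $|\beta|+2|\gamma|=k+1$, $$[\mathcal{R}f]_{\beta\gamma}(x)=\frac{(-1)^{|\beta|}|\beta|}{\beta!}\int_0^1(1-t)^{|\beta|-1}\Big(\frac xt\Big)^{\beta}\int_{\mathbb{R}^n}f\Big(\frac xt,y\Big)y^\gamma\,dy\,\frac{dt}{t^m}.$$ Moreover, for $1\le p<\frac{n}{n-1}$ and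 $|\gamma|=\frac{k+1}{2}$, $$\|F_\gamma\|_{L^p(\mathbb{R}^N)}\le\||y|^{\frac{k+1}{2}}f\|_{L^p(\mathbb{R}^N)},$$ and, for $1\le p<\frac{m}{m-1}$, $|\gamma|\le\frac{k-1}{2}$ and $|\beta|+2|\gamma|=k+1$, $$\|[\mathcal{R}f]_{\beta\gamma}\|_{L^p(\mathbb{R}^m)}\le\|f\|_{L^p(\mathbb{R}^m,|x|^{|\beta|};\,L^1(\mathbb{R}^n,|y|^{|\gamma|}))}.$$
   Context: $\mathcal{D}(\mathbb{R}^N)$ is the space of $C^\infty$ compactly supported functions. Points of $\mathbb{R}^N$ are $(x,y)\in\mathbb{R}^m\times\mathbb{R}^n$; $\beta\in\mathbb{Z}_{\ge0}^m$ and $\gamma\in\mathbb{Z}_{\ge0}^n$ are multi-indices. $\delta_0$ is the Dirac mass at the origin of $\mathbb{R}^N$, $\delta_0(y)$ the Dirac mass at the origin of $\mathbb{R}^n$, and $D_x^\beta g(x)\,D_y^\gamma\delta_0(y)$ is the tensor product of distributions. The mixed norm is $$\|f\|^p_{L^p(\mathbb{R}^m,|x|^{|\beta|};\,L^1(\mathbb{R}^n,|y|^{|\gamma|}))}=\int_{\mathbb{R}^m}|x|^{p|\beta|}\Big(\int_{\mathbb{R}^n}|y|^{|\gamma|}|f(x,y)|\,dy\Big)^p dx.$$ The convention $\frac10=\infty$ is used for the exponents.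
   Formalization: Both norm inequalities are proved with an extra factor on the right, (|α|/α!)·B(|α|, d/p−d+1), with α=γ, d=n for F_γ and α=β, d=m for Rf; with constant 1 as printed they fail in general for p>1 (Hardy's inequality), though the factor is at most 1 at p=1. *)

theory Defs
  imports "HOL-Analysis.Analysis"
begin

section \<open>Multi-indices\<close>

text \<open>A multi-index of length \<open>CARD('i)\<close> is a function \<open>\<alpha> :: 'i \<Rightarrow> nat\<close>.\<close>

definition mi_size :: "('i::finite \<Rightarrow> nat) \<Rightarrow> nat" where
  "mi_size \<alpha> = (\<Sum>i\<in>UNIV. \<alpha> i)"

definition mi_fact :: "('i::finite \<Rightarrow> nat) \<Rightarrow> real" where
  "mi_fact \<alpha> = (\<Prod>i\<in>UNIV. fact (\<alpha> i))"

definition mi_pow :: "real ^ 'i \<Rightarrow> ('i::finite \<Rightarrow> nat) \<Rightarrow> real" where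
  "mi_pow x \<alpha> = (\<Prod>i\<in>UNIV. (x $ i) ^ \<alpha> i)"

section \<open>Test functions\<close>

definition partial :: "'a::real_normed_vector \<Rightarrow> ('a \<Rightarrow> complex) \<Rightarrow> 'a \<Rightarrow> complex" where
  "partial v \<phi> = (\<lambda>z. frechet_derivative \<phi> (at z) v)"

primrec Ck :: "nat \<Rightarrow> ('a::euclidean_space \<Rightarrow> complex) \<Rightarrow> bool" where
  "Ck 0 \<phi> \<longleftrightarrow> continuous_on UNIV \<phi>"
| "Ck (Suc r) \<phi> \<longleftrightarrow> (\<forall>z. \<phi> differentiable (at z)) \<and> (\<forall>b\<in>Basis. Ck r (partial b \<phi>))"

definition test_function :: "('a::euclidean_space \<Rightarrow> complex) \<Rightarrow> bool" where
  "test_function \<phi> \<longleftrightarrow> (\<forall>r. Ck r \<phi>) \<and> compact (closure {z. \<phi> z \<noteq> 0})"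

text \<open>
  An index type of class \<open>finite\<close> carries no order, so the order in which the partial
  derivatives are taken is an arbitrary fixed enumeration; for smooth functions it does not
  matter, by the symmetry of higher derivatives.  The family \<open>e\<close> gives the directions:
  \<open>coord\<close> on \<open>real ^ 'i\<close>, and \<open>xdir\<close>, \<open>ydir\<close> for the two groups of variables on the product.
\<close>

definition index_list :: "'i::finite list" where
  "index_list = (SOME is. distinct is \<and> set is = UNIV)"

definition mi_deriv ::
  "('i::finite \<Rightarrow> 'a::real_normed_vector) \<Rightarrow> ('i \<Rightarrow> nat) \<Rightarrow> ('a \<Rightarrow> complex) \<Rightarrow> 'a \<Rightarrow> complex" where
  "mi_deriv e \<alpha> \<phi> = foldr (\<lambda>i. partial (e i) ^^ \<alpha> i) index_list \<phi>"

definition coord :: "'i::finite \<Rightarrow> real ^ 'i" where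
  "coord i = axis i 1"

definition xdir :: "'m::finite \<Rightarrow> (real ^ 'm) \<times> (real ^ 'n::finite)" where
  "xdir i = (axis i 1, 0)"

definition ydir :: "'n::finite \<Rightarrow> (real ^ 'm::finite) \<times> (real ^ 'n)" where
  "ydir j = (0, axis j 1)"

section \<open>Distributions\<close>

text \<open>
  A distribution is given by its action on test functions; two distributions are equal when
  they agree on every \<open>\<phi>\<close> with \<open>test_function \<phi>\<close>.
\<close>

type_synonym 'a distr = "('a \<Rightarrow> complex) \<Rightarrow> complex"

definition distr_of_fun :: "('a::euclidean_space \<Rightarrow> complex) \<Rightarrow> 'a distr" where
  "distr_of_fun g \<phi> = (LINT z|lborel. g z * \<phi> z)"

definition dirac :: "'a::real_normed_vector distr" where
  "dirac \<phi> = \<phi> 0"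

definition distr_deriv ::
  "('i::finite \<Rightarrow> 'a::real_normed_vector) \<Rightarrow> ('i \<Rightarrow> nat) \<Rightarrow> 'a distr \<Rightarrow> 'a distr" where
  "distr_deriv e \<alpha> T \<phi> = (- 1) ^ mi_size \<alpha> * T (mi_deriv e \<alpha> \<phi>)"

definition distr_tensor :: "'a distr \<Rightarrow> 'b distr \<Rightarrow> ('a \<times> 'b) distr" where
  "distr_tensor S T \<phi> = S (\<lambda>x. T (\<lambda>y. \<phi> (x, y)))"

section \<open>Lebesgue norms\<close>

definition in_Lp :: "real \<Rightarrow> ('a::euclidean_space \<Rightarrow> complex) \<Rightarrow> bool" where
  "in_Lp p g \<longleftrightarrow> g \<in> borel_measurable lborel \<and> integrable lborel (\<lambda>z. norm (g z) powr p)"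

definition Lp_norm :: "real \<Rightarrow> ('a::euclidean_space \<Rightarrow> complex) \<Rightarrow> real" where
  "Lp_norm p g = (LINT z|lborel. norm (g z) powr p) powr (1 / p)"

text \<open>The norm of \<open>L\<^sup>p(\<real>\<^sup>m, |x|\<^sup>a; L\<^sup>1(\<real>\<^sup>n, |y|\<^sup>b))\<close>.\<close>

definition mixed_norm ::
  "real \<Rightarrow> nat \<Rightarrow> nat \<Rightarrow> ((real ^ 'm::finite) \<times> (real ^ 'n::finite) \<Rightarrow> complex) \<Rightarrow> real" where
  "mixed_norm p a b f =
    (LINT x|lborel. norm x powr (p * real a) *
       (LINT y|lborel. norm y ^ b * norm (f (x, y))) powr p) powr (1 / p)"

definition crit_exp :: "nat \<Rightarrow> ereal" where
  "crit_exp d = ereal (real d) / ereal (real d - 1)"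

lemma crit_exp_1: "crit_exp 1 = \<infinity>"
  by (simp add: crit_exp_def divide_ereal_def)

section \<open>The remainder terms\<close>

definition F_rem ::
  "nat \<Rightarrow> ('n::finite \<Rightarrow> nat) \<Rightarrow> ((real ^ 'm::finite) \<times> (real ^ 'n) \<Rightarrow> complex) \<Rightarrow>
    (real ^ 'm) \<times> (real ^ 'n) \<Rightarrow> complex" where
  "F_rem k \<gamma> f = (\<lambda>(x, y).
     complex_of_real (real (k + 1) / 2 * ((- 1) ^ ((k + 1) div 2) / mi_fact \<gamma>)) *
     (LINT t:{0<..<1}|lborel.
        complex_of_real ((1 - t) ^ ((k - 1) div 2) * mi_pow (y /\<^sub>R t) \<gamma> / t ^ CARD('n)) *
        f (x, y /\<^sub>R t)))"

definition R_rem ::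
  "('m::finite \<Rightarrow> nat) \<Rightarrow> ('n::finite \<Rightarrow> nat) \<Rightarrow> ((real ^ 'm) \<times> (real ^ 'n) \<Rightarrow> complex) \<Rightarrow>
    real ^ 'm \<Rightarrow> complex" where
  "R_rem \<beta> \<gamma> f = (\<lambda>x.
     complex_of_real ((- 1) ^ mi_size \<beta> * real (mi_size \<beta>) / mi_fact \<beta>) *
     (LINT t:{0<..<1}|lborel.
        complex_of_real ((1 - t) ^ (mi_size \<beta> - 1) * mi_pow (x /\<^sub>R t) \<beta> / t ^ CARD('m)) *
        (LINT y|lborel. f (x /\<^sub>R t, y) * complex_of_real (mi_pow y \<gamma>))))"

text \<open>
  Since \<open>\<parallel>g(\<cdot>/t)\<parallel>\<^sub>p = t\<^bsup>d/p\<^esup> \<parallel>g\<parallel>\<^sub>p\<close> on \<open>\<real>\<^sup>d\<close>, Minkowski's integral inequality bounds both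
  remainders with the constant
  \<open>|\<alpha>|/\<alpha>! \<integral>\<^sub>0\<^sup>1 (1 - t)\<^bsup>|\<alpha>|-1\<^esup> t\<^bsup>d/p-d\<^esup> dt\<close>, which is finite exactly for \<open>p < d/(d-1)\<close>.
  It is at most 1 for \<open>p = 1\<close>, but it cannot be replaced by 1 in general:
  for \<open>d = |\<alpha>| = 1\<close> it equals \<open>p\<close>, the sharp constant in Hardy's inequality.
\<close>

definition dilation_const :: "real \<Rightarrow> ('i::finite \<Rightarrow> nat) \<Rightarrow> real" where
  "dilation_const p \<alpha> = real (mi_size \<alpha>) / mi_fact \<alpha> *
     Beta (real (mi_size \<alpha>)) (real CARD('i) / p - real CARD('i) + 1)"

lemma dilation_const_1_le:
  fixes \<alpha> :: "'i::finite \<Rightarrow> nat"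
  assumes "mi_size \<alpha> > 0"
  shows "dilation_const 1 \<alpha> \<le> 1"
proof -
  let ?a = "real (mi_size \<alpha>)"
  have "?a \<notin> \<int>\<^sub>\<le>\<^sub>0"
    using assms by (auto elim!: nonpos_Ints_cases)
  then have "Gamma (?a + 1) = ?a * Gamma ?a"
    by (rule Gamma_plus1)
  moreover have "Gamma ?a \<noteq> 0"
    using Gamma_real_pos[of ?a] assms by linarith
  ultimately have "Beta ?a 1 = 1 / ?a"
    using assms by (simp add: Beta_def)
  moreover have "mi_fact \<alpha> \<ge> 1"
    unfolding mi_fact_def by (intro prod_ge_1) (simp add: fact_ge_1)
  ultimately show ?thesis
    using assms by (simp add: dilation_const_def)
qed

end

theory Submission
  imports Defs
begin

text \<open>
  Apply Taylor's formula with integral remainder to the test function, first in \<open>y\<close> about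
  \<open>y = 0\<close> to order \<open>(k + 1) / 2\<close>, then in \<open>x\<close> about \<open>x = 0\<close> to order \<open>k + 1 - 2|\<gamma>|\<close> in each
  coefficient \<open>D\<^sub>y\<^sup>\<gamma>\<phi>(x, 0)\<close>, and integrate against \<open>f\<close>.  The substitutions
  \<open>y \<rightarrow> y / t\<close> and \<open>x \<rightarrow> x / t\<close> turn the remainder integrals
  \<open>\<integral>\<^sub>0\<^sup>1 (1 - t)\<^sup>a\<^sup>-\<^sup>1 \<psi>(t z) dt\<close> into pairings of \<open>\<psi>\<close> with averages over dilations,
  \<open>\<integral>\<^sub>0\<^sup>1 (1 - t)\<^sup>a\<^sup>-\<^sup>1 t\<^sup>-\<^sup>d g(z / t) dt\<close>.  For the norm bounds, Jensen's inequality for the Beta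
  weight \<open>(1 - t)\<^sup>a\<^sup>-\<^sup>1 t\<^bsup>d/p-d\<^esup>\<close> replaces Minkowski's integral inequality and gives the same constant.
\<close>

section \<open>Smooth functions and their iterated partial derivatives\<close>

text \<open>Count each x-derivative with weight 1 and each y-derivative with weight 2. As k is odd,
  k + 1 is an even number 2K; stopping in y at order K and in x at order k + 1 - 2|\<gamma>| leaves
  derivatives of weight exactly k + 1 in both remainders. Since only the test function is expanded,
  f is never differentiated: its fibre integrals over y merely have to be measurable, bounded and
  compactly supported, and no differentiation under the integral sign occurs. The enumeration behind
  \<open>mi_deriv\<close> is arbitrary, while differentiating along a segment adds each new partial
  derivative on the outside, so commutation of partial derivatives has to precede Taylor's formula.
  The range of p is the integrability of the Beta weight at t = 0: d/p - d > -1 means p < d/(d-1),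
  and it holds for every p when d = 1.\<close>

definition smooth :: "('a::euclidean_space \<Rightarrow> complex) \<Rightarrow> bool" where
  "smooth \<phi> \<longleftrightarrow> (\<forall>r. Ck r \<phi>)"

lemma smooth_imp_differentiable: "smooth \<phi> \<Longrightarrow> \<phi> differentiable (at z)"
  unfolding smooth_def by (metis Ck.simps(2))

lemma smooth_imp_continuous: "smooth \<phi> \<Longrightarrow> continuous_on S \<phi>"
  unfolding smooth_def by (metis Ck.simps(1) continuous_on_subset top_greatest)

lemma smooth_partial: "smooth \<phi> \<Longrightarrow> b \<in> Basis \<Longrightarrow> smooth (partial b \<phi>)"
  unfolding smooth_def by (metis Ck.simps(2))

lemma smooth_has_vector_derivative:
  assumes "smooth \<phi>"
  shows "((\<lambda>s. \<phi> (z + s *\<^sub>R v)) has_vector_derivative partial v \<phi> (z + s *\<^sub>R v)) (at s)"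
proof -
  let ?D = "frechet_derivative \<phi> (at (z + s *\<^sub>R v))"
  have D: "(\<phi> has_derivative ?D) (at (z + s *\<^sub>R v))"
    using smooth_imp_differentiable[OF assms] frechet_derivative_works by blast
  have "((\<lambda>s. \<phi> (z + s *\<^sub>R v)) has_derivative (\<lambda>h. ?D (h *\<^sub>R v))) (at s)"
    by (rule has_derivative_compose[where g = \<phi> and f = "\<lambda>s. z + s *\<^sub>R v", OF _ D]) (auto intro!: derivative_eq_intros)
  moreover have "(\<lambda>h. ?D (h *\<^sub>R v)) = (\<lambda>h. h *\<^sub>R ?D v)"
    using has_derivative_linear[OF D] by (auto simp: linear_cmul)
  ultimately show ?thesis
    by (simp add: has_vector_derivative_def partial_def)
qed

lemma partial_sum:
  assumes "smooth \<phi>"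
  shows "partial (\<Sum>i\<in>I. c i *\<^sub>R e i) \<phi> z = (\<Sum>i\<in>I. c i *\<^sub>R partial (e i) \<phi> z)"
proof -
  have "linear (frechet_derivative \<phi> (at z))"
    using linear_frechet_derivative smooth_imp_differentiable[OF assms] by blast
  then show ?thesis
    by (simp add: partial_def linear_sum linear_cmul)
qed

section \<open>Symmetry of mixed second derivatives\<close>

lemma second_difference_mvt:
  fixes g :: "real \<Rightarrow> real \<Rightarrow> real"
  assumes "\<And>s t. ((\<lambda>s. g s t) has_real_derivative ga s t) (at s)"
    and "\<And>s t. ((\<lambda>t. ga s t) has_real_derivative gab s t) (at t)"
    and "0 < h"
  shows "\<exists>s t. 0 < s \<and> s < h \<and> 0 < t \<and> t < h \<and>
    g h h - g h 0 - g 0 h + g 0 0 = h\<^sup>2 * gab s t"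
proof -
  \<comment> \<open>The second difference is the increment over [0, h] of
    \<open>g s h - g s 0\<close> as a function of \<open>s\<close>; the mean value theorem in
    \<open>s\<close> and then in \<open>t\<close> produces one factor \<open>h\<close> each.\<close>
  have "((\<lambda>s. g s h - g s 0) has_real_derivative (ga s h - ga s 0)) (at s)" for s
    by (intro DERIV_diff assms(1))
  from MVT2[of 0 h "\<lambda>s. g s h - g s 0" "\<lambda>s. ga s h - ga s 0", OF \<open>0 < h\<close> this]
  obtain s where s: "0 < s" "s < h"
    "(g h h - g h 0) - (g 0 h - g 0 0) = (h - 0) * (ga s h - ga s 0)"
    by blast
  from MVT2[of 0 h "ga s" "gab s", OF \<open>0 < h\<close> assms(2)]
  obtain t where t: "0 < t" "t < h" "ga s h - ga s 0 = (h - 0) * gab s t"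
    by blast
  have "g h h - g h 0 - g 0 h + g 0 0 = h\<^sup>2 * gab s t"
    using s(3) unfolding t(3) by (simp add: power2_eq_square)
  then show ?thesis
    using s t by blast
qed

text \<open>The second difference over a square does not depend on which variable is treated first,
  so it equals h^2 times either mixed derivative, at points of the square that may differ. Both
  points tend to the corner as the square shrinks, and continuity there identifies the two
  values.\<close>

lemma mixed_derivatives_eq:
  fixes g :: "real \<Rightarrow> real \<Rightarrow> real"
  assumes Da: "\<And>s t. ((\<lambda>s. g s t) has_real_derivative ga s t) (at s)"
    and Dab: "\<And>s t. ((\<lambda>t. ga s t) has_real_derivative gab s t) (at t)"
    and Db: "\<And>s t. ((\<lambda>t. g s t) has_real_derivative gb s t) (at t)"
    and Dba: "\<And>s t. ((\<lambda>s. gb s t) has_real_derivative gba s t) (at s)"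
    and cab: "isCont (\<lambda>(s, t). gab s t) (0, 0)"
    and cba: "isCont (\<lambda>(s, t). gba s t) (0, 0)"
  shows "gab 0 0 = gba 0 0"
proof -
  define h where "h n = inverse (real (Suc n))" for n
  have h: "h n > 0" for n
    by (simp add: h_def)
  have hlim: "h \<longlonglongrightarrow> 0"
    unfolding h_def[abs_def] by (rule LIMSEQ_inverse_real_of_nat)
  have "\<forall>n. \<exists>s t s' t'. 0 < s \<and> s < h n \<and> 0 < t \<and> t < h n \<and>
     0 < s' \<and> s' < h n \<and> 0 < t' \<and> t' < h n \<and> gab s t = gba s' t'"
  proof
    fix n
    obtain s t where 1: "0 < s" "s < h n" "0 < t" "t < h n"
      "g (h n) (h n) - g (h n) 0 - g 0 (h n) + g 0 0 = (h n)\<^sup>2 * gab s t"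
      using second_difference_mvt[of g ga gab, OF Da Dab h[of n]] by blast
    obtain s' t' where 2: "0 < s'" "s' < h n" "0 < t'" "t' < h n"
      "g (h n) (h n) - g 0 (h n) - g (h n) 0 + g 0 0 = (h n)\<^sup>2 * gba s' t'"
      using second_difference_mvt[of "\<lambda>t s. g s t" "\<lambda>t s. gb s t" "\<lambda>t s. gba s t",
          OF Db Dba h[of n]] by blast
    have "(h n)\<^sup>2 * gab s t = (h n)\<^sup>2 * gba s' t'"
      using 1(5) 2(5) by linarith
    then have "gab s t = gba s' t'"
      using h[of n] by simp
    then show "\<exists>s t s' t'. 0 < s \<and> s < h n \<and> 0 < t \<and> t < h n \<and>
        0 < s' \<and> s' < h n \<and> 0 < t' \<and> t' < h n \<and> gab s t = gba s' t'"
      using 1 2 by blast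
  qed
  then obtain s t s' t' where st: "\<And>n. 0 < s n \<and> s n < h n \<and> 0 < t n \<and> t n < h n \<and>
     0 < s' n \<and> s' n < h n \<and> 0 < t' n \<and> t' n < h n \<and> gab (s n) (t n) = gba (s' n) (t' n)"
    by metis
  have lim: "u \<longlonglongrightarrow> 0" if "\<And>n. 0 < u n \<and> u n < h n" for u :: "nat \<Rightarrow> real"
    by (rule real_tendsto_sandwich[OF _ _ tendsto_const hlim])
      (use that in \<open>auto intro!: always_eventually less_imp_le\<close>)
  have "(\<lambda>n. (s n, t n)) \<longlonglongrightarrow> (0, 0)"
    by (intro tendsto_Pair lim) (use st in auto)
  from isCont_tendsto_compose[OF cab this] have 1: "(\<lambda>n. gab (s n) (t n)) \<longlonglongrightarrow> gab 0 0"
    by simp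
  have "(\<lambda>n. (s' n, t' n)) \<longlonglongrightarrow> (0, 0)"
    by (intro tendsto_Pair lim) (use st in auto)
  from isCont_tendsto_compose[OF cba this] have 2: "(\<lambda>n. gba (s' n) (t' n)) \<longlonglongrightarrow> gba 0 0"
    by simp
  show ?thesis
    using 1 2 st by (simp add: LIMSEQ_unique)
qed

text \<open>The mean value theorem fails for complex values, so symmetry is tested after composition
  with a real functional \<open>L\<close>; \<open>Re\<close> and \<open>Im\<close> together
  determine the complex number.\<close>

lemma partial_commute:
  assumes "smooth \<phi>" "b \<in> Basis" "c \<in> Basis"
  shows "partial b (partial c \<phi>) = partial c (partial b \<phi>)"
proof
  fix z
  have *: "L (partial b (partial c \<phi>) z) = L (partial c (partial b \<phi>) z)"
    if L: "bounded_linear L" for L :: "complex \<Rightarrow> real"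
  proof -
    note bl = bounded_linear.has_vector_derivative[OF L smooth_has_vector_derivative,
        folded has_real_derivative_iff_has_vector_derivative]
    have cont: "isCont (\<lambda>(s, t). L (\<psi> (z + s *\<^sub>R b + t *\<^sub>R c))) (0, 0)" if "smooth \<psi>" for \<psi>
    proof -
      have "continuous_on UNIV (\<lambda>w. L (\<psi> w))"
        using smooth_imp_continuous[OF that] bounded_linear.continuous_on[OF L] by blast
      then have "continuous_on UNIV (\<lambda>p. L (\<psi> (z + fst p *\<^sub>R b + snd p *\<^sub>R c)))"
        by (rule continuous_on_compose2) (auto intro!: continuous_intros)
      then show ?thesis
        by (simp add: continuous_on_eq_continuous_at case_prod_unfold)
    qed
    have "L (partial c (partial b \<phi>) (z + 0 *\<^sub>R b + 0 *\<^sub>R c)) =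
        L (partial b (partial c \<phi>) (z + 0 *\<^sub>R b + 0 *\<^sub>R c))"
    proof (rule mixed_derivatives_eq[where g = "\<lambda>s t. L (\<phi> (z + s *\<^sub>R b + t *\<^sub>R c))"
          and ga = "\<lambda>s t. L (partial b \<phi> (z + s *\<^sub>R b + t *\<^sub>R c))"
          and gb = "\<lambda>s t. L (partial c \<phi> (z + s *\<^sub>R b + t *\<^sub>R c))"
          and gab = "\<lambda>s t. L (partial c (partial b \<phi>) (z + s *\<^sub>R b + t *\<^sub>R c))"
          and gba = "\<lambda>s t. L (partial b (partial c \<phi>) (z + s *\<^sub>R b + t *\<^sub>R c))"])
      show "((\<lambda>s. L (\<phi> (z + s *\<^sub>R b + t *\<^sub>R c))) has_real_derivative
          L (partial b \<phi> (z + s *\<^sub>R b + t *\<^sub>R c))) (at s)" for s t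
        using bl[OF assms(1), of "z + t *\<^sub>R c" b s] by (simp add: algebra_simps)
      show "((\<lambda>s. L (partial c \<phi> (z + s *\<^sub>R b + t *\<^sub>R c))) has_real_derivative
          L (partial b (partial c \<phi>) (z + s *\<^sub>R b + t *\<^sub>R c))) (at s)" for s t
        using bl[OF smooth_partial[OF assms(1,3)], of "z + t *\<^sub>R c" b s]
        by (simp add: algebra_simps)
    qed (use assms in \<open>auto intro!: bl cont smooth_partial\<close>)
    then show ?thesis
      by simp
  qed
  show "partial b (partial c \<phi>) z = partial c (partial b \<phi>) z"
    using *[OF bounded_linear_Re] *[OF bounded_linear_Im] by (simp add: complex_eq_iff)
qed

section \<open>Iterated partial derivatives and the order in which they are taken\<close>

lemma smooth_partial_funpow: "smooth \<phi> \<Longrightarrow> b \<in> Basis \<Longrightarrow> smooth ((partial b ^^ r) \<phi>)"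
  by (induction r) (auto intro: smooth_partial)

lemma partial_funpow_commute:
  assumes "smooth \<phi>" "b \<in> Basis" "c \<in> Basis"
  shows "partial b ((partial c ^^ r) \<phi>) = (partial c ^^ r) (partial b \<phi>)"
proof (induction r)
  case (Suc r)
  then show ?case
    using partial_commute[OF smooth_partial_funpow[OF assms(1,3)] assms(2,3), of r] by simp
qed simp

lemma smooth_foldr_partial:
  "smooth \<phi> \<Longrightarrow> (\<And>i. e i \<in> Basis) \<Longrightarrow> smooth (foldr (\<lambda>i. partial (e i) ^^ \<alpha> i) is \<phi>)"
  by (induction "is") (auto intro: smooth_partial_funpow)

lemma partial_foldr_commute:
  assumes "smooth \<phi>" "\<And>i. e i \<in> Basis" "b \<in> Basis"
  shows "partial b (foldr (\<lambda>i. partial (e i) ^^ \<alpha> i) is \<phi>) =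
    foldr (\<lambda>i. partial (e i) ^^ \<alpha> i) is (partial b \<phi>)"
  by (induction "is")
    (use assms in \<open>auto simp: partial_funpow_commute smooth_foldr_partial\<close>)

text \<open>The additional derivative arises at the position of \<open>j\<close> inside the fold;
  \<open>partial_funpow_commute\<close> moves it outward past the directions that precede
  \<open>j\<close>, and distinctness keeps \<open>j\<close> from occurring a second time.\<close>

lemma foldr_partial_Suc:
  assumes "smooth \<phi>" "\<And>i. e i \<in> Basis" "distinct is" "j \<in> set is"
  shows "foldr (\<lambda>i. partial (e i) ^^ (\<alpha>(j := Suc (\<alpha> j))) i) is \<phi> =
    partial (e j) (foldr (\<lambda>i. partial (e i) ^^ \<alpha> i) is \<phi>)"
  using assms(3,4)
proof (induction "is")
  case (Cons a "is")
  show ?case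
  proof (cases "a = j")
    case True
    then have "j \<notin> set is"
      using Cons.prems by simp
    then have "foldr (\<lambda>i. partial (e i) ^^ (\<alpha>(j := Suc (\<alpha> j))) i) is \<phi> =
        foldr (\<lambda>i. partial (e i) ^^ \<alpha> i) is \<phi>"
      by (intro foldr_cong) auto
    then show ?thesis
      using True by simp
  next
    case False
    then show ?thesis
      using Cons assms(1,2)
      by (simp add: partial_funpow_commute smooth_foldr_partial)
  qed
qed simp

lemma index_list: "distinct (index_list :: 'i::finite list)" "set (index_list :: 'i list) = UNIV"
proof -
  have "\<exists>is. distinct is \<and> set is = (UNIV :: 'i set)"
    using finite_distinct_list[OF finite_class.finite_UNIV] by blast
  from someI_ex[OF this]
  show "distinct (index_list :: 'i::finite list)" "set (index_list :: 'i list) = UNIV"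
    by (auto simp: index_list_def)
qed

lemma smooth_mi_deriv:
  "smooth \<phi> \<Longrightarrow> (\<And>i. e i \<in> Basis) \<Longrightarrow> smooth (mi_deriv e \<alpha> \<phi>)"
  unfolding mi_deriv_def by (rule smooth_foldr_partial)

lemma mi_deriv_Suc:
  assumes "smooth \<phi>" "\<And>i. e i \<in> Basis"
  shows "mi_deriv e (\<alpha>(j := Suc (\<alpha> j))) \<phi> = partial (e j) (mi_deriv e \<alpha> \<phi>)"
  unfolding mi_deriv_def by (rule foldr_partial_Suc) (use assms index_list in auto)

lemma mi_deriv_0: "mi_deriv e (\<lambda>_. 0) \<phi> = \<phi>"
proof -
  have "foldr (\<lambda>i. partial (e i) ^^ 0) is \<phi> = \<phi>" for "is"
    by (induction "is") auto
  then show ?thesis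
    by (simp add: mi_deriv_def)
qed

lemma mi_deriv_commute:
  fixes e :: "'i::finite \<Rightarrow> 'a::euclidean_space" and e' :: "'j::finite \<Rightarrow> 'a"
  assumes "smooth \<phi>" "\<And>i. e i \<in> Basis" "\<And>j. e' j \<in> Basis"
  shows "mi_deriv e \<alpha> (mi_deriv e' \<alpha>' \<phi>) = mi_deriv e' \<alpha>' (mi_deriv e \<alpha> \<phi>)"
proof -
  let ?E = "\<lambda>js. foldr (\<lambda>j. partial (e' j) ^^ \<alpha>' j) js"
  have pow: "(partial b ^^ r) (?E js \<psi>) = ?E js ((partial b ^^ r) \<psi>)"
    if "smooth \<psi>" "b \<in> Basis" for b r js \<psi>
    using that
    by (induction r) (auto simp: partial_foldr_commute assms smooth_partial_funpow)
  have "foldr (\<lambda>i. partial (e i) ^^ \<alpha> i) is (?E js \<phi>) =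
      ?E js (foldr (\<lambda>i. partial (e i) ^^ \<alpha> i) is \<phi>)" for "is" js
    by (induction "is") (auto simp: pow smooth_foldr_partial assms)
  then show ?thesis
    by (simp add: mi_deriv_def)
qed

section \<open>Supports of derivatives\<close>

lemma partial_eq_0_outside_support:
  assumes "z \<notin> closure {z. \<phi> z \<noteq> 0}"
  shows "partial v \<phi> z = 0"
proof -
  have "((\<lambda>_. 0) has_derivative (\<lambda>_. 0 :: complex)) (at z)"
    by simp
  then have "(\<phi> has_derivative (\<lambda>_. 0)) (at z)"
    by (rule has_derivative_transform_within_open[where s = "- closure {z. \<phi> z \<noteq> 0}"])
      (use assms closure_subset[of "{z. \<phi> z \<noteq> 0}"] in auto)
  then show ?thesis
    by (simp add: partial_def flip: frechet_derivative_at)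
qed

text \<open>Off the closed support a function vanishes on an open set, so each
  \<open>partial\<close> can only shrink the closed support. The iteration runs over inclusions of
  closures because vanishing at the single point \<open>z\<close> would not survive a further
  derivative.\<close>

lemma mi_deriv_eq_0_outside_support:
  assumes "z \<notin> closure {z. \<phi> z \<noteq> 0}"
  shows "mi_deriv e \<alpha> \<phi> z = 0"
proof -
  let ?S = "\<lambda>\<psi>. closure {z. \<psi> z \<noteq> (0::complex)}"
  have part: "?S (partial v \<psi>) \<subseteq> ?S \<psi>" for v and \<psi> :: "'a \<Rightarrow> complex"
    by (rule closure_minimal) (use partial_eq_0_outside_support[of _ \<psi> v] in auto)
  have pow: "?S ((partial v ^^ r) \<psi>) \<subseteq> ?S \<psi>" for v r and \<psi> :: "'a \<Rightarrow> complex"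
  proof (induction r)
    case (Suc r)
    then show ?case
      using order_trans[OF part] by simp
  qed simp
  have "?S (foldr (\<lambda>i. partial (e i) ^^ \<alpha> i) is \<phi>) \<subseteq> ?S \<phi>" for "is"
  proof (induction "is")
    case (Cons a "is")
    then show ?case
      using order_trans[OF pow] by simp
  qed simp
  then have "z \<notin> closure {z. mi_deriv e \<alpha> \<phi> z \<noteq> 0}"
    using assms by (auto simp: mi_deriv_def)
  then show ?thesis
    using closure_subset[of "{z. mi_deriv e \<alpha> \<phi> z \<noteq> 0}"] by auto
qed

text \<open>Carries derivatives taken on a factor over to \<open>xdir\<close> or \<open>ydir\<close>
  on the product: \<open>L\<close> is the inclusion of a factor, \<open>w\<close> fixes the other
  coordinate, and \<open>c\<close> absorbs the sign left by an inner distributional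
  derivative.\<close>

lemma mi_deriv_compose_affine:
  fixes e :: "'i::finite \<Rightarrow> 'a::euclidean_space" and L :: "real ^ 'i \<Rightarrow> 'a"
  assumes sm: "smooth \<eta>" and e: "\<And>i. e i \<in> Basis" and L: "bounded_linear L"
    and Le: "\<And>i. L (coord i) = e i"
  shows "mi_deriv coord \<alpha> (\<lambda>u. c * \<eta> (w + L u)) = (\<lambda>u. c * mi_deriv e \<alpha> \<eta> (w + L u))"
proof -
  have part: "partial (coord i) (\<lambda>u. c * \<eta> (w + L u)) = (\<lambda>u. c * partial (e i) \<eta> (w + L u))"
    if "smooth \<eta>" for \<eta> i
  proof
    fix u
    let ?D = "frechet_derivative \<eta> (at (w + L u))"
    have D: "(\<eta> has_derivative ?D) (at (w + L u))"
      using smooth_imp_differentiable[OF that] frechet_derivative_works by blast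
    have "((\<lambda>u. w + L u) has_derivative L) (at u)"
      using bounded_linear.has_derivative[OF L has_derivative_ident] has_derivative_add[OF has_derivative_const]
      by fastforce
    then have "((\<lambda>u. \<eta> (w + L u)) has_derivative (\<lambda>v. ?D (L v))) (at u)"
      by (rule has_derivative_compose[where g = \<eta>]) (rule D)
    then have "((\<lambda>u. c * \<eta> (w + L u)) has_derivative (\<lambda>v. c * ?D (L v))) (at u)"
      by (rule has_derivative_mult_right)
    from frechet_derivative_at[OF this]
    show "partial (coord i) (\<lambda>u. c * \<eta> (w + L u)) u = c * partial (e i) \<eta> (w + L u)"
      by (simp add: partial_def Le[symmetric] fun_eq_iff)
  qed
  have pow: "(partial (coord i) ^^ r) (\<lambda>u. c * \<eta> (w + L u)) =
      (\<lambda>u. c * (partial (e i) ^^ r) \<eta> (w + L u))" if "smooth \<eta>" for \<eta> i r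
    by (induction r) (simp_all add: part smooth_partial_funpow that e)
  have "foldr (\<lambda>i. partial (coord i) ^^ \<alpha> i) is (\<lambda>u. c * \<eta> (w + L u)) =
      (\<lambda>u. c * foldr (\<lambda>i. partial (e i) ^^ \<alpha> i) is \<eta> (w + L u))" for "is"
    by (induction "is") (simp_all add: pow smooth_foldr_partial sm e)
  then show ?thesis
    by (simp add: mi_deriv_def)
qed

lemma xdir_Basis: "xdir i \<in> Basis" and ydir_Basis: "ydir j \<in> Basis"
  by (auto simp: xdir_def ydir_def Basis_prod_def axis_in_Basis_iff)

lemma sum_xdir: "(\<Sum>i\<in>UNIV. (x $ i) *\<^sub>R xdir i) = (x, 0)"
  and sum_ydir: "(\<Sum>j\<in>UNIV. (y $ j) *\<^sub>R ydir j) = (0, y)"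
  by (simp_all add: prod_eq_iff xdir_def ydir_def fst_sum snd_sum vec_eq_iff axis_def
      if_distrib[where f = "(*) _"] cong: if_cong)

lemma test_function_smooth: "test_function f \<Longrightarrow> smooth f"
  by (simp add: test_function_def smooth_def)

lemma test_function_support:
  assumes "test_function f"
  obtains K where "compact K" "\<And>z. z \<notin> K \<Longrightarrow> f z = 0" "\<And>e \<alpha> z. z \<notin> K \<Longrightarrow> mi_deriv e \<alpha> f z = 0"
proof (rule that)
  show "compact (closure {z. f z \<noteq> 0})"
    using assms by (simp add: test_function_def)
  show "f z = 0" if "z \<notin> closure {z. f z \<noteq> 0}" for z
    using that closure_subset[of "{z. f z \<noteq> 0}"] by auto
qed (rule mi_deriv_eq_0_outside_support)

section \<open>Taylor's formula in multi-index form\<close>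

lemma finite_mi_size_le [simp]: "finite {\<alpha> :: 'i::finite \<Rightarrow> nat. mi_size \<alpha> \<le> k}"
proof (rule finite_subset)
  show "{\<alpha> :: 'i \<Rightarrow> nat. mi_size \<alpha> \<le> k} \<subseteq> PiE UNIV (\<lambda>_. {..k})"
  proof
    fix \<alpha> :: "'i \<Rightarrow> nat"
    assume "\<alpha> \<in> {\<alpha>. mi_size \<alpha> \<le> k}"
    moreover have "\<alpha> i \<le> mi_size \<alpha>" for i
      unfolding mi_size_def by (rule member_le_sum) auto
    ultimately show "\<alpha> \<in> PiE UNIV (\<lambda>_. {..k})"
      by (auto intro: order_trans)
  qed
qed (auto intro: finite_PiE)

lemma finite_mi_size_eq [simp]: "finite {\<alpha> :: 'i::finite \<Rightarrow> nat. mi_size \<alpha> = k}"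
  by (rule finite_subset[OF _ finite_mi_size_le[of k]]) auto

lemma finite_mi_size_less [simp]: "finite {\<alpha> :: 'i::finite \<Rightarrow> nat. mi_size \<alpha> < k}"
  by (rule finite_subset[OF _ finite_mi_size_le[of k]]) auto

lemma mi_size_Suc [simp]: "mi_size (\<alpha>(j := Suc (\<alpha> j))) = Suc (mi_size \<alpha>)"
proof -
  have "(\<Sum>i\<in>UNIV - {j}. (\<alpha>(j := Suc (\<alpha> j))) i) = (\<Sum>i\<in>UNIV - {j}. \<alpha> i)"
    by (rule sum.cong) auto
  then show ?thesis
    by (simp add: mi_size_def sum.remove[of UNIV j])
qed

lemma mi_fact_Suc: "mi_fact (\<alpha>(j := Suc (\<alpha> j))) = real (Suc (\<alpha> j)) * mi_fact \<alpha>"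
proof -
  have "(\<Prod>i\<in>UNIV - {j}. fact ((\<alpha>(j := Suc (\<alpha> j))) i)) = (\<Prod>i\<in>UNIV - {j}. fact (\<alpha> i) :: real)"
    by (rule prod.cong) auto
  then show ?thesis
    by (simp add: mi_fact_def prod.remove[of UNIV j])
qed

lemma mi_pow_Suc: "mi_pow x (\<alpha>(j := Suc (\<alpha> j))) = x $ j * mi_pow x \<alpha>"
proof -
  have "(\<Prod>i\<in>UNIV - {j}. x $ i ^ (\<alpha>(j := Suc (\<alpha> j))) i) = (\<Prod>i\<in>UNIV - {j}. x $ i ^ \<alpha> i)"
    by (rule prod.cong) auto
  then show ?thesis
    by (simp add: mi_pow_def prod.remove[of UNIV j])
qed

lemma mi_fact_pos: "mi_fact \<alpha> > 0"
  unfolding mi_fact_def by (intro prod_pos) auto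

lemma mi_size_eq_0: "{\<alpha> :: 'i::finite \<Rightarrow> nat. mi_size \<alpha> = 0} = {\<lambda>_. 0}"
  by (auto simp: mi_size_def)

text \<open>The sum on the left runs over all ways of raising one entry of a multi-index of size \<open>r\<close>;
  the multi-index \<open>\<beta>\<close> of size \<open>r + 1\<close> arises with total weight \<open>\<Sum>\<^sub>j \<beta>\<^sub>j / \<beta>! = (r + 1) / \<beta>!\<close>.\<close>

lemma sum_mi_Suc:
  fixes H :: "('i::finite \<Rightarrow> nat) \<Rightarrow> 'b::real_vector"
  shows "(\<Sum>\<alpha> | mi_size \<alpha> = r. \<Sum>j\<in>UNIV. (1 / mi_fact \<alpha>) *\<^sub>R H (\<alpha>(j := Suc (\<alpha> j)))) =
    (\<Sum>\<beta> | mi_size \<beta> = Suc r. (real (Suc r) / mi_fact \<beta>) *\<^sub>R H \<beta>)"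
proof -
  have inner: "(\<Sum>\<alpha> | mi_size \<alpha> = r. (1 / mi_fact \<alpha>) *\<^sub>R H (\<alpha>(j := Suc (\<alpha> j)))) =
      (\<Sum>\<beta> | mi_size \<beta> = Suc r. (real (\<beta> j) / mi_fact \<beta>) *\<^sub>R H \<beta>)" for j
  proof -
    have "(\<Sum>\<alpha> | mi_size \<alpha> = r. (1 / mi_fact \<alpha>) *\<^sub>R H (\<alpha>(j := Suc (\<alpha> j)))) =
        (\<Sum>\<beta> | mi_size \<beta> = Suc r \<and> \<beta> j \<noteq> 0. (real (\<beta> j) / mi_fact \<beta>) *\<^sub>R H \<beta>)"
    proof (rule sum.reindex_bij_witness[where i = "\<lambda>\<beta>. \<beta>(j := \<beta> j - 1)"
          and j = "\<lambda>\<alpha>. \<alpha>(j := Suc (\<alpha> j))"], goal_cases)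
      case (4 \<beta>)
      then show ?case
        using mi_size_Suc[of "\<beta>(j := \<beta> j - 1)" j] by (auto simp: fun_upd_idem)
    next
      case (5 \<alpha>)
      then show ?case
        by (simp add: mi_fact_Suc)
    qed (auto simp: fun_upd_idem)
    also have "\<dots> = (\<Sum>\<beta> | mi_size \<beta> = Suc r. (real (\<beta> j) / mi_fact \<beta>) *\<^sub>R H \<beta>)"
      by (rule sum.mono_neutral_left) auto
    finally show ?thesis .
  qed
  have "(\<Sum>\<alpha> | mi_size \<alpha> = r. \<Sum>j\<in>UNIV. (1 / mi_fact \<alpha>) *\<^sub>R H (\<alpha>(j := Suc (\<alpha> j)))) =
      (\<Sum>j\<in>UNIV. \<Sum>\<beta> | mi_size \<beta> = Suc r. (real (\<beta> j) / mi_fact \<beta>) *\<^sub>R H \<beta>)"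
    by (subst sum.swap) (simp add: inner)
  also have "\<dots> = (\<Sum>\<beta> | mi_size \<beta> = Suc r. \<Sum>j\<in>UNIV. (real (\<beta> j) / mi_fact \<beta>) *\<^sub>R H \<beta>)"
    by (rule sum.swap)
  also have "\<dots> = (\<Sum>\<beta> | mi_size \<beta> = Suc r. (real (Suc r) / mi_fact \<beta>) *\<^sub>R H \<beta>)"
  proof (rule sum.cong[OF refl])
    fix \<beta> :: "'i \<Rightarrow> nat"
    assume "\<beta> \<in> {\<beta>. mi_size \<beta> = Suc r}"
    then have "(\<Sum>j\<in>UNIV. real (\<beta> j)) = real (Suc r)"
      by (simp add: mi_size_def flip: of_nat_sum)
    then show "(\<Sum>j\<in>UNIV. (real (\<beta> j) / mi_fact \<beta>) *\<^sub>R H \<beta>) =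
        (real (Suc r) / mi_fact \<beta>) *\<^sub>R H \<beta>"
      by (simp flip: scaleR_sum_left sum_divide_distrib)
  qed
  finally show ?thesis .
qed

text \<open>This is the one-variable Taylor formula on [0, 1] for the restriction of
  \<open>\<phi>\<close> to the segment from \<open>z\<close> to \<open>z + v\<close>; the r-fold
  derivative along \<open>v\<close> is a sum over multi-indices with multinomial weights
  r!/\<alpha>!. The remainder is taken over the open interval, to match the dilation integrals with
  which it is later paired.\<close>

lemma taylor_mi:
  fixes e :: "'i::finite \<Rightarrow> 'a::euclidean_space" and c :: "real ^ 'i"
  assumes sm: "smooth \<phi>" and e: "\<And>i. e i \<in> Basis" and M: "0 < M"
    and v: "v = (\<Sum>i\<in>UNIV. (c $ i) *\<^sub>R e i)"
  shows "\<phi> (z + v) =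
     (\<Sum>\<alpha> | mi_size \<alpha> < M. complex_of_real (mi_pow c \<alpha> / mi_fact \<alpha>) * mi_deriv e \<alpha> \<phi> z) +
     (\<Sum>\<alpha> | mi_size \<alpha> = M. complex_of_real (real M * mi_pow c \<alpha> / mi_fact \<alpha>) *
       (LINT s:{0<..<1}|lborel.
          complex_of_real ((1 - s) ^ (M - 1)) * mi_deriv e \<alpha> \<phi> (z + s *\<^sub>R v)))"
proof -
  note D_smooth = smooth_mi_deriv[where e = e, OF sm e]
  note D_Suc = mi_deriv_Suc[where e = e, OF sm e]
  \<comment> \<open>\<open>Df r\<close> is the r-th derivative of \<open>\<phi>\<close> along the
    segment, already expanded by the multinomial theorem; \<open>deriv\<close> verifies this one
    order at a time through \<open>sum_mi_Suc\<close>.\<close>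
  define Df where "Df r s = (\<Sum>\<alpha> | mi_size \<alpha> = r.
    (fact r * mi_pow c \<alpha> / mi_fact \<alpha>) *\<^sub>R mi_deriv e \<alpha> \<phi> (z + s *\<^sub>R v))" for r s
  have D0: "Df 0 s = \<phi> (z + s *\<^sub>R v)" for s
    by (simp add: Df_def mi_size_eq_0 mi_deriv_0 mi_pow_def mi_fact_def)
  have deriv: "(Df r has_vector_derivative Df (Suc r) s) (at s)" for r s
  proof -
    have "((\<lambda>s. mi_deriv e \<alpha> \<phi> (z + s *\<^sub>R v)) has_vector_derivative
        (\<Sum>j\<in>UNIV. (c $ j) *\<^sub>R mi_deriv e (\<alpha>(j := Suc (\<alpha> j))) \<phi> (z + s *\<^sub>R v))) (at s)" for \<alpha>
      using smooth_has_vector_derivative[OF D_smooth[of \<alpha>], of z v s]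
      by (simp add: v partial_sum[OF D_smooth] D_Suc)
    then have "(Df r has_vector_derivative (\<Sum>\<alpha> | mi_size \<alpha> = r. (fact r * mi_pow c \<alpha> / mi_fact \<alpha>) *\<^sub>R
        (\<Sum>j\<in>UNIV. (c $ j) *\<^sub>R mi_deriv e (\<alpha>(j := Suc (\<alpha> j))) \<phi> (z + s *\<^sub>R v)))) (at s)"
      unfolding Df_def[abs_def]
      by (intro has_vector_derivative_sum bounded_linear.has_vector_derivative[OF bounded_linear_scaleR_right])
    also have "(\<Sum>\<alpha> | mi_size \<alpha> = r. (fact r * mi_pow c \<alpha> / mi_fact \<alpha>) *\<^sub>R
        (\<Sum>j\<in>UNIV. (c $ j) *\<^sub>R mi_deriv e (\<alpha>(j := Suc (\<alpha> j))) \<phi> (z + s *\<^sub>R v))) =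
      fact r *\<^sub>R (\<Sum>\<alpha> | mi_size \<alpha> = r. \<Sum>j\<in>UNIV. (1 / mi_fact \<alpha>) *\<^sub>R
        (mi_pow c (\<alpha>(j := Suc (\<alpha> j))) *\<^sub>R mi_deriv e (\<alpha>(j := Suc (\<alpha> j))) \<phi> (z + s *\<^sub>R v)))"
      by (simp add: scaleR_sum_right mi_pow_Suc mult_ac)
    also have "\<dots> = Df (Suc r) s"
      by (subst sum_mi_Suc) (simp add: Df_def scaleR_sum_right mult_ac)
    finally show ?thesis .
  qed
  let ?i = "\<lambda>s. ((1 - s) ^ (M - 1) / fact (M - 1)) *\<^sub>R Df M s"
  have taylor: "Df 0 1 = (\<Sum>r<M. ((1 - 0) ^ r / fact r) *\<^sub>R Df r 0) + integral {0..1} ?i"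
    by (rule Taylor_integral[OF M refl])
      (auto intro: has_vector_derivative_at_within deriv)
  have part1: "(\<Sum>r<M. ((1 - 0) ^ r / fact r) *\<^sub>R Df r 0) =
      (\<Sum>\<alpha> | mi_size \<alpha> < M. complex_of_real (mi_pow c \<alpha> / mi_fact \<alpha>) * mi_deriv e \<alpha> \<phi> z)"
  proof -
    have "(\<Sum>\<alpha> | mi_size \<alpha> < M. complex_of_real (mi_pow c \<alpha> / mi_fact \<alpha>) * mi_deriv e \<alpha> \<phi> z) =
       (\<Sum>r\<in>{..<M}. \<Sum>\<alpha>\<in>{\<alpha>\<in>{\<alpha>. mi_size \<alpha> < M}. mi_size \<alpha> = r}.
         complex_of_real (mi_pow c \<alpha> / mi_fact \<alpha>) * mi_deriv e \<alpha> \<phi> z)"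
      by (rule sum.group[symmetric]) auto
    also have "\<dots> = (\<Sum>r<M. ((1 - 0) ^ r / fact r) *\<^sub>R Df r 0)"
    proof (rule sum.cong[OF refl])
      fix r
      assume "r \<in> {..<M}"
      then have "{\<alpha> \<in> {\<alpha> :: 'i \<Rightarrow> nat. mi_size \<alpha> < M}. mi_size \<alpha> = r} = {\<alpha>. mi_size \<alpha> = r}"
        by auto
      then show "(\<Sum>\<alpha>\<in>{\<alpha>\<in>{\<alpha>. mi_size \<alpha> < M}. mi_size \<alpha> = r}.
          complex_of_real (mi_pow c \<alpha> / mi_fact \<alpha>) * mi_deriv e \<alpha> \<phi> z) =
          ((1 - 0) ^ r / fact r) *\<^sub>R Df r 0"
        by (simp add: Df_def scaleR_sum_right) (simp add: scaleR_conv_of_real)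
    qed
    finally show ?thesis
      by simp
  qed
  have cont: "continuous_on {0..1} (\<lambda>s. complex_of_real ((1 - s) ^ (M - 1)) *
      mi_deriv e \<alpha> \<phi> (z + s *\<^sub>R v))" for \<alpha>
    by (intro continuous_intros continuous_on_compose2[OF smooth_imp_continuous[OF D_smooth, where S=UNIV]]) auto
  have seti: "set_integrable lborel {0<..<1} (\<lambda>s. complex_of_real ((1 - s) ^ (M - 1)) *
      mi_deriv e \<alpha> \<phi> (z + s *\<^sub>R v))" for \<alpha>
    by (rule set_integrable_subset[of _ "{0..1}"])
      (use borel_integrable_compact[OF compact_Icc cont] in \<open>auto simp: set_integrable_def\<close>)
  have hi: "((\<lambda>s. complex_of_real ((1 - s) ^ (M - 1)) * mi_deriv e \<alpha> \<phi> (z + s *\<^sub>R v)) has_integral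
      (LINT s:{0<..<1}|lborel. complex_of_real ((1 - s) ^ (M - 1)) * mi_deriv e \<alpha> \<phi> (z + s *\<^sub>R v)))
      {0..1}" for \<alpha>
    unfolding has_integral_Icc_iff_Ioo set_borel_integral_eq_integral(2)[OF seti]
    using set_borel_integral_eq_integral(1)[OF seti] by (rule integrable_integral)
  have "(?i has_integral (\<Sum>\<alpha> | mi_size \<alpha> = M. complex_of_real (real M * mi_pow c \<alpha> / mi_fact \<alpha>) *
       (LINT s:{0<..<1}|lborel.
          complex_of_real ((1 - s) ^ (M - 1)) * mi_deriv e \<alpha> \<phi> (z + s *\<^sub>R v)))) {0..1}"
  proof -
    have i_eq: "?i = (\<lambda>s. \<Sum>\<alpha> | mi_size \<alpha> = M. complex_of_real (real M * mi_pow c \<alpha> / mi_fact \<alpha>) *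
       (complex_of_real ((1 - s) ^ (M - 1)) * mi_deriv e \<alpha> \<phi> (z + s *\<^sub>R v)))"
    proof
      fix s
      \<comment> \<open>The quotient \<open>fact M / fact (M - 1)\<close> is the origin of the
        factor \<open>real M\<close>, and hence of the orders in the prefactors of both
        remainders.\<close>
      have "((1 - s) ^ (M - 1) / fact (M - 1)) * (fact M * mi_pow c \<alpha> / mi_fact \<alpha>) =
          (real M * mi_pow c \<alpha> / mi_fact \<alpha>) * (1 - s) ^ (M - 1)" for \<alpha> :: "'i \<Rightarrow> nat"
        by (simp add: fact_reduce[OF M])
      then show "?i s = (\<Sum>\<alpha> | mi_size \<alpha> = M. complex_of_real (real M * mi_pow c \<alpha> / mi_fact \<alpha>) *
          (complex_of_real ((1 - s) ^ (M - 1)) * mi_deriv e \<alpha> \<phi> (z + s *\<^sub>R v)))"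
        by (simp only: Df_def scaleR_sum_right scaleR_scaleR)
          (simp only: scaleR_conv_of_real mult.assoc of_real_mult)
    qed
    show ?thesis
      unfolding i_eq by (intro has_integral_sum has_integral_mult_right hi finite_mi_size_eq)
  qed
  from taylor[unfolded part1 integral_unique[OF this] D0] show ?thesis
    by simp
qed

section \<open>Averages over dilations\<close>

lemma powr_above_tangent:
  fixes A u p :: real
  assumes "1 \<le> p" "0 \<le> A" "0 \<le> u"
  shows "A powr p + p * A powr (p - 1) * (u - A) \<le> u powr p"
proof (cases "A = 0 \<or> u = 0")
  \<comment> \<open>The tangent criterion is applied at positive points only, so the boundary is
    treated by hand. With \<open>A = 0\<close> the left side is 0 even for \<open>p = 1\<close>,
    because \<open>0 powr 0 = 0\<close>; with \<open>u = 0 < A\<close> it is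
    \<open>(1 - p) * A powr p\<close>.\<close>
  case True
  have "A powr p = A * A powr (p - 1)" if "A > 0"
    using that by (simp add: powr_mult_base)
  then have "A powr p - p * (A powr (p - 1) * A) \<le> 0" if "A > 0"
    using that assms(1) by simp
  then show ?thesis
    using True assms by (cases "A = 0") (auto simp: mult.assoc)
next
  case False
  then have pos: "A > 0" "u > 0"
    using assms by auto
  have "p * A powr (p - 1) * (u - A) \<le> u powr p - A powr p"
    by (rule convex_on_imp_above_tangent[OF powr_convex[OF assms(1)]])
      (use pos in \<open>auto intro!: derivative_eq_intros simp: interior_open\<close>)
  then show ?thesis
    by simp
qed

text \<open>Integrate the tangent inequality at the weighted mean of \<open>u\<close> against
  \<open>c\<close>. The weight has mass C instead of 1, which accounts for the factor
  C^(p-1).\<close>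

lemma weighted_jensen_powr:
  fixes c u :: "'b \<Rightarrow> real"
  assumes p: "1 \<le> p" and c: "\<And>t. 0 \<le> c t" and u: "\<And>t. 0 \<le> u t"
    and [measurable]: "u \<in> borel_measurable M" and ic: "integrable M c"
    and icu: "integrable M (\<lambda>t. c t * u t powr p)" and pos: "0 < integral\<^sup>L M c"
  shows "(LINT t|M. c t * u t) powr p \<le> integral\<^sup>L M c powr (p - 1) * (LINT t|M. c t * u t powr p)"
proof -
  have [measurable]: "c \<in> borel_measurable M"
    using ic by auto
  \<comment> \<open>Finite mass of \<open>c\<close> and integrability of
    \<open>c t * u t powr p\<close> thereby control \<open>c t * u t\<close>, so the mean
    exists.\<close>
  have "u t \<le> 1 + u t powr p" for t
  proof (cases "u t \<le> 1")
    case False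
    then have "u t powr 1 \<le> u t powr p"
      by (intro powr_mono p) auto
    with False show ?thesis
      by simp
  qed (simp add: add_increasing2)
  then have bd: "c t * u t \<le> c t + c t * u t powr p" for t
    using mult_left_mono[OF _ c[of t], of "u t" "1 + u t powr p"] by (simp add: distrib_left)
  have int: "integrable M (\<lambda>t. c t * u t)"
    by (rule Bochner_Integration.integrable_bound[OF Bochner_Integration.integrable_add[OF ic icu]])
      (use bd c u in \<open>auto intro!: AE_I2 simp: abs_of_nonneg\<close>)
  define C where "C = integral\<^sup>L M c"
  define A where "A = (LINT t|M. c t * u t) / C"
  have "0 \<le> (LINT t|M. c t * u t)"
    by (intro Bochner_Integration.integral_nonneg) (use c u in auto)
  then have A: "0 \<le> A"
    using pos by (simp add: A_def C_def)
  have AC: "(LINT t|M. c t * u t) = A * C"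
    using pos by (simp add: A_def C_def)
  \<comment> \<open>\<open>a + b * u\<close> is the tangent line of the power at \<open>A\<close>.
    After integration against \<open>c\<close> the terms with the factor \<open>p\<close> cancel,
    precisely because \<open>A\<close> is the mean.\<close>
  define a where "a = A powr p - p * A powr (p - 1) * A"
  define b where "b = p * A powr (p - 1)"
  have "(LINT t|M. a * c t + b * (c t * u t)) \<le> (LINT t|M. c t * u t powr p)"
  proof (rule Bochner_Integration.integral_mono)
    show "a * c t + b * (c t * u t) \<le> c t * u t powr p" for t
      using mult_left_mono[OF powr_above_tangent[OF p A u[of t]] c[of t]]
      by (simp add: a_def b_def algebra_simps)
  qed (use ic int icu in auto)
  moreover have "(LINT t|M. a * c t + b * (c t * u t)) = a * C + b * (A * C)"
    using ic int by (simp add: AC C_def)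
  moreover have "a * C + b * (A * C) = A powr p * C"
    by (simp add: a_def b_def algebra_simps)
  ultimately have "A powr p * C \<le> (LINT t|M. c t * u t powr p)"
    by simp
  then have "C powr (p - 1) * (A powr p * C) \<le> C powr (p - 1) * (LINT t|M. c t * u t powr p)"
    by (intro mult_left_mono) auto
  moreover have "C powr (p - 1) * (A powr p * C) = (A * C) powr p"
  proof -
    have "C powr (p - 1) * C = C powr p"
      using pos powr_mult_base[of C "p - 1"] by (simp add: C_def mult.commute)
    then show ?thesis
      using A pos by (simp add: powr_mult C_def mult_ac)
  qed
  ultimately show ?thesis
    by (simp add: AC C_def)
qed

text \<open>Covers both \<open>z \<mapsto> z / t\<close> on \<open>\<real>\<^sup>d\<close> and the partial dilation \<open>(x, y) \<mapsto> (x, y / t)\<close>.\<close>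

locale dilation =
  fixes D :: "real \<Rightarrow> 'a::euclidean_space \<Rightarrow> 'a" and d :: nat
  assumes D_measurable: "(\<lambda>p. D (fst p) (snd p)) \<in> borel_measurable (borel \<Otimes>\<^sub>M borel)"
    and distr_D: "0 < t \<Longrightarrow> distr lborel borel (D t) = density lborel (\<lambda>_. ennreal (t ^ d))"
    and D_inverse: "0 < t \<Longrightarrow> D (inverse t) (D t z) = z"
begin

lemma measurable_D [measurable (raw)]:
  assumes [measurable]: "s \<in> borel_measurable N" "h \<in> borel_measurable N"
  shows "(\<lambda>w. D (s w) (h w)) \<in> borel_measurable N"
proof -
  have "(\<lambda>w. (s w, h w)) \<in> N \<rightarrow>\<^sub>M borel \<Otimes>\<^sub>M borel"
    by measurable
  from measurable_compose[OF this D_measurable] show ?thesis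
    by simp
qed

lemma
  fixes h :: "'a \<Rightarrow> 'c::{banach, second_countable_topology}"
  assumes [measurable]: "h \<in> borel_measurable borel" and t: "0 < t"
  shows integral_D: "(LINT z|lborel. h (D t z)) = t ^ d *\<^sub>R (LINT z|lborel. h z)"
    and integrable_D: "integrable lborel h \<Longrightarrow> integrable lborel (\<lambda>z. h (D t z))"
proof -
  have "(LINT z|lborel. h (D t z)) = integral\<^sup>L (distr lborel borel (D t)) h"
    by (rule integral_distr[symmetric]) measurable
  also have "\<dots> = t ^ d *\<^sub>R (LINT z|lborel. h z)"
    using t by (simp add: distr_D integral_density)
  finally show "(LINT z|lborel. h (D t z)) = t ^ d *\<^sub>R (LINT z|lborel. h z)" .
  assume "integrable lborel h"
  then have "integrable (distr lborel borel (D t)) h"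
    using t by (simp add: distr_D integrable_density)
  then show "integrable lborel (\<lambda>z. h (D t z))"
    by (subst (asm) integrable_distr_eq) auto
qed

definition average :: "nat \<Rightarrow> ('a \<Rightarrow> complex) \<Rightarrow> 'a \<Rightarrow> complex" where
  "average a g z =
    (LINT t:{0<..<1}|lborel. complex_of_real ((1 - t) ^ (a - 1) / t ^ d) * g (D t z))"

lemma measurable_average [measurable]:
  assumes [measurable]: "g \<in> borel_measurable borel"
  shows "average a g \<in> borel_measurable borel"
  unfolding average_def[abs_def] set_lebesgue_integral_def by measurable

text \<open>The kernel splits as (1-t)^(a-1) t^(-d) = c(t) t^(-d/p), where c is the Beta weight. The
  power t^(-d/p) goes into \<open>u\<close>, so that for every t in (0, 1) the L^p norm of
  \<open>u\<close> in z equals that of \<open>g\<close>. Jensen in t at fixed z, followed by Fubini,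
  yields C^(p-1) C times the p-th power of this norm, with C the mass of c.\<close>

lemma average_Lp:
  assumes g: "in_Lp p g" and p: "1 \<le> p" and a: "0 < a"
    and b: "0 < real d / p - real d + 1"
  shows "in_Lp p (average a g)"
    and "Lp_norm p (average a g) \<le> Beta (real a) (real d / p - real d + 1) * Lp_norm p g"
proof -
  define b where "b = real d / p - real d + 1"
  define C where "C = Beta (real a) b"
  define I where "I = (LINT z|lborel. norm (g z) powr p)"
  define c where "c t = indicator {0<..<1} t * (t powr (b - 1) * (1 - t) powr (real a - 1))" for t :: real
  define u where "u z t = t powr (- real d / p) * norm (g (D t z))" for t z
  have [measurable]: "g \<in> borel_measurable borel" and ig: "integrable lborel (\<lambda>z. norm (g z) powr p)"
    using g by (auto simp: in_Lp_def)
  have b0: "0 < b"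
    using assms(4) by (simp add: b_def)
  have [measurable]: "c \<in> borel_measurable borel"
    unfolding c_def[abs_def] by measurable
  have c_nonneg: "0 \<le> c t" for t
    by (auto simp: c_def indicator_def)
  have cB: "set_integrable lborel {0<..<1} (\<lambda>t. t powr (b - 1) * (1 - t) powr (real a - 1))"
    by (rule set_integrable_subset[OF integrable_Beta]) (use b0 a in auto)
  then have ic: "integrable lborel c"
    by (simp add: set_integrable_def c_def[abs_def])
  have "integral\<^sup>L lborel c = (LINT t:{0<..<1}|lborel. t powr (b - 1) * (1 - t) powr (real a - 1))"
    by (simp add: c_def[abs_def] set_lebesgue_integral_def)
  also have "\<dots> = integral {0<..<1} (\<lambda>t. t powr (b - 1) * (1 - t) powr (real a - 1))"
    by (rule set_borel_integral_eq_integral(2)[OF cB])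
  also have "\<dots> = Beta b (real a)"
    using has_integral_Beta_real[of b "real a"] b0 a
    by (intro integral_unique) (simp add: has_integral_Icc_iff_Ioo)
  finally have intc: "integral\<^sup>L lborel c = C"
    by (simp add: C_def Beta_commute)
  have C0: "0 < C"
    unfolding C_def Beta_def using b0 a by (intro divide_pos_pos mult_pos_pos Gamma_real_pos) auto
  have u_nonneg: "0 \<le> u z t" for z t
    by (simp add: u_def)
  have [measurable]: "(\<lambda>q. u (snd q) (fst q)) \<in> borel_measurable (lborel \<Otimes>\<^sub>M lborel)"
    unfolding u_def by measurable
  have [measurable]: "u z \<in> borel_measurable lborel" for z
    unfolding u_def[abs_def] by measurable
  define H where "H t z = c t * u z t powr p" for t z
  have Hm [measurable]: "case_prod H \<in> borel_measurable (lborel \<Otimes>\<^sub>M lborel)"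
    unfolding H_def case_prod_unfold by measurable
  have H_nonneg: "0 \<le> H t z" for t z
    using c_nonneg by (simp add: H_def)
  have H_eq: "H t z = c t * t powr (- real d) * norm (g (D t z)) powr p" for t z
  proof (cases "t \<in> {0<..<1}")
    case True
    then have "u z t powr p = (t powr (- real d / p)) powr p * norm (g (D t z)) powr p"
      by (simp add: u_def powr_mult)
    also have "(t powr (- real d / p)) powr p = t powr (- real d)"
      using p by (simp add: powr_powr)
    finally show ?thesis
      by (simp add: H_def)
  qed (simp add: H_def c_def)
  have H_int: "integrable lborel (H t)" and H_val: "(LINT z|lborel. H t z) = c t * I" for t
  proof -
    have "integrable lborel (H t) \<and> (LINT z|lborel. H t z) = c t * I"
    proof (cases "t \<in> {0<..<1}")
      case True
      then have t: "0 < t"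
        by simp
      have "integrable lborel (\<lambda>z. norm (g (D t z)) powr p)"
        by (rule integrable_D[OF _ t ig]) measurable
      moreover have "(LINT z|lborel. norm (g (D t z)) powr p) = t ^ d * I"
        using integral_D[of "\<lambda>z. norm (g z) powr p", OF _ t] by (simp add: I_def)
      \<comment> \<open>The normalisation built into \<open>u\<close> cancels the Jacobian of the
        dilation.\<close>
      moreover have "t powr (- real d) * t ^ d = 1"
        using t by (simp add: powr_minus powr_realpow)
      ultimately show ?thesis
        by (simp add: H_eq[abs_def])
    qed (simp add: H_def[abs_def] c_def)
    then show "integrable lborel (H t)" "(LINT z|lborel. H t z) = c t * I"
      by auto
  qed
  have HP: "integrable (lborel \<Otimes>\<^sub>M lborel) (case_prod H)"
  proof (rule lborel_pair.Fubini_integrable)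
    show "integrable lborel (\<lambda>t. LINT z|lborel. norm (case (t, z) of (t, z) \<Rightarrow> H t z))"
      using ic by (simp add: abs_of_nonneg[OF H_nonneg] H_val)
  qed (auto simp: H_int)
  have H_total: "(LINT z|lborel. LINT t|lborel. H t z) = C * I"
    using lborel_pair.Fubini_integral[OF HP] ic by (simp add: H_val intc)
  have bound: "norm (average a g z) \<le> (LINT t|lborel. c t * u z t)" for z
  proof -
    have "norm (average a g z) \<le> (LINT t|lborel. norm (indicator {0<..<1} t *\<^sub>R
        (complex_of_real ((1 - t) ^ (a - 1) / t ^ d) * g (D t z))))"
      unfolding average_def set_lebesgue_integral_def by (rule integral_norm_bound)
    also have "\<dots> = (LINT t|lborel. c t * u z t)"
    proof (rule Bochner_Integration.integral_cong[OF refl])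
      fix t :: real
      show "norm (indicator {0<..<1} t *\<^sub>R (complex_of_real ((1 - t) ^ (a - 1) / t ^ d) * g (D t z)))
          = c t * u z t"
      proof (cases "t \<in> {0<..<1}")
        case True
        then have t: "0 < t" "t < 1"
          by auto
        have "t powr (b - 1) * t powr (- real d / p) = t powr (- real d)"
          unfolding powr_add[symmetric] by (simp add: b_def)
        also have "\<dots> = inverse (t ^ d)"
          using t by (simp add: powr_minus powr_realpow)
        finally have 1: "t powr (b - 1) * t powr (- real d / p) = inverse (t ^ d)" .
        have 2: "(1 - t) powr (real a - 1) = (1 - t) ^ (a - 1)"
          using t a powr_realpow[of "1 - t" "a - 1"] by (simp add: of_nat_diff)
        have "c t * u z t = (t powr (b - 1) * t powr (- real d / p)) * (1 - t) powr (real a - 1) *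
            norm (g (D t z))"
          using t by (simp add: c_def u_def)
        also have "\<dots> = (1 - t) ^ (a - 1) / t ^ d * norm (g (D t z))"
          unfolding 1 2 by (simp add: field_simps)
        also have "\<dots> = norm (complex_of_real ((1 - t) ^ (a - 1) / t ^ d) * g (D t z))"
          using t by (simp only: norm_mult norm_of_real) (simp add: abs_of_nonneg)
        finally show ?thesis
          using t by simp
      qed (simp add: c_def)
    qed
    finally show ?thesis .
  qed
  \<comment> \<open>Only almost every \<open>z\<close>: Fubini gives the integrability of
    \<open>H t z\<close> in \<open>t\<close>, which Jensen requires, off a null set.\<close>
  have AE_bound: "AE z in lborel. norm (average a g z) powr p \<le> C powr (p - 1) * (LINT t|lborel. H t z)"
    using lborel_pair.AE_integrable_snd[OF HP]
  proof eventually_elim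
    case (elim z)
    have "norm (average a g z) powr p \<le> (LINT t|lborel. c t * u z t) powr p"
      by (rule powr_mono2[OF _ _ bound]) (use p in auto)
    also have "\<dots> \<le> C powr (p - 1) * (LINT t|lborel. H t z)"
      using weighted_jensen_powr[of p c "u z" lborel, OF p c_nonneg u_nonneg _ ic] elim C0
      by (simp add: intc H_def)
    finally show ?case .
  qed
  have iH: "integrable lborel (\<lambda>z. C powr (p - 1) * (LINT t|lborel. H t z))"
    using lborel_pair.integrable_snd[OF HP] by simp
  have iA: "integrable lborel (\<lambda>z. norm (average a g z) powr p)"
    by (rule Bochner_Integration.integrable_bound[OF iH]) (use AE_bound in auto)
  then show "in_Lp p (average a g)"
    by (simp add: in_Lp_def)
  have I0: "0 \<le> I"
    by (simp add: I_def)
  have "(LINT z|lborel. norm (average a g z) powr p) \<le> C powr (p - 1) * (C * I)"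
    using integral_mono_AE[OF iA iH AE_bound] by (simp add: H_total)
  also have "\<dots> = C powr p * I"
    using C0 powr_mult_base[of C "p - 1"] by (simp add: mult_ac)
  finally have "Lp_norm p (average a g) \<le> (C powr p * I) powr (1 / p)"
    unfolding Lp_norm_def by (rule powr_mono2[rotated 2]) (use p in auto)
  also have "\<dots> = C * Lp_norm p g"
    using p C0 I0 by (simp add: powr_mult powr_powr Lp_norm_def I_def)
  finally show "Lp_norm p (average a g) \<le> Beta (real a) (real d / p - real d + 1) * Lp_norm p g"
    by (simp add: C_def b_def)
qed

text \<open>Fubini, with a change of variables at each fixed t: \<open>D t\<close> carries g(D t z)
  \<psi>(z) into g(z) \<psi>(D (1/t) z), and its Jacobian t^d cancels the denominator of the kernel.
  Boundedness of \<open>\<psi>\<close> and integrability of \<open>g\<close> give absolute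
  convergence in spite of the singularity at t = 0.\<close>

lemma average_duality:
  fixes a :: nat
  assumes ig: "integrable lborel g" and [measurable]: "\<psi> \<in> borel_measurable borel"
    and B: "\<And>z. norm (\<psi> z) \<le> B"
  defines "S \<equiv> \<lambda>z. LINT s:{0<..<1}|lborel. complex_of_real ((1 - s) ^ (a - 1)) * \<psi> (D (inverse s) z)"
  shows "integrable lborel (\<lambda>z. g z * S z)"
    and "(LINT z|lborel. average a g z * \<psi> z) = (LINT z|lborel. g z * S z)"
proof -
  have [measurable]: "g \<in> borel_measurable borel"
    using ig by auto
  have B0: "0 \<le> B"
    using B[of undefined] norm_ge_zero order_trans by blast
  define w :: "real \<Rightarrow> real" where "w t = indicator {0<..<1} t * (1 - t) ^ (a - 1)" for t
  have [measurable]: "w \<in> borel_measurable borel"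
    unfolding w_def[abs_def] by measurable
  have w_nonneg: "0 \<le> w t" for t
    by (auto simp: w_def indicator_def)
  have iw: "integrable lborel w"
  proof -
    have "set_integrable lborel {0..1} (\<lambda>t::real. (1 - t) ^ (a - 1))"
      unfolding set_integrable_def by (intro borel_integrable_compact continuous_intros compact_Icc)
    then have "set_integrable lborel {0<..<1} (\<lambda>t::real. (1 - t) ^ (a - 1))"
      by (rule set_integrable_subset) auto
    then show ?thesis
      by (simp add: set_integrable_def w_def[abs_def])
  qed
  \<comment> \<open>Majorant for the pairing, up to the factor \<open>B\<close>. The singular 1/t^d
    is harmless since integration over z contributes t^d and leaves the integrable
    \<open>w t\<close>.\<close>
  define G where "G t z = w t / t ^ d * norm (g (D t z))" for t z
  have [measurable]: "case_prod G \<in> borel_measurable (lborel \<Otimes>\<^sub>M lborel)"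
    unfolding G_def case_prod_unfold by measurable
  have G_int: "integrable lborel (G t) \<and> (LINT z|lborel. norm (G t z)) = w t * (LINT z|lborel. norm (g z))"
    for t
  proof (cases "t \<in> {0<..<1}")
    case True
    then have t: "0 < t"
      by simp
    have "integrable lborel (\<lambda>z. norm (g (D t z)))"
      by (rule integrable_D[OF _ t integrable_norm[OF ig]]) measurable
    moreover have "(LINT z|lborel. norm (g (D t z))) = t ^ d * (LINT z|lborel. norm (g z))"
      using integral_D[of "\<lambda>z. norm (g z)", OF _ t] by simp
    moreover have "norm (G t z) = G t z" for z
      using t w_nonneg[of t] by (simp add: G_def)
    ultimately show ?thesis
      using t by (simp add: G_def[abs_def])
  qed (simp add: G_def[abs_def] w_def)
  have GP: "integrable (lborel \<Otimes>\<^sub>M lborel) (case_prod G)"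
    by (rule lborel_pair.Fubini_integrable) (use G_int iw in auto)
  define H1 where "H1 t z = complex_of_real (w t / t ^ d) * g (D t z) * \<psi> z" for t z
  have [measurable]: "case_prod H1 \<in> borel_measurable (lborel \<Otimes>\<^sub>M lborel)"
    unfolding H1_def case_prod_unfold by measurable
  have H1P: "integrable (lborel \<Otimes>\<^sub>M lborel) (case_prod H1)"
  proof (rule Bochner_Integration.integrable_bound[OF integrable_mult_right[OF GP, of B]])
    have "norm (H1 t z) \<le> norm (B * G t z)" for t z
    proof -
      have "norm (H1 t z) = norm (G t z) * norm (\<psi> z)"
        by (simp only: H1_def G_def norm_mult norm_of_real real_norm_def abs_mult abs_norm_cancel)
      also have "\<dots> \<le> norm (G t z) * B"
        by (intro mult_left_mono B) auto
      finally show ?thesis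
        using B0 by (simp add: abs_mult mult.commute)
    qed
    then show "AE p in lborel \<Otimes>\<^sub>M lborel. norm (case_prod H1 p) \<le> norm (B * case_prod G p)"
      by (simp add: case_prod_unfold)
  qed measurable
  define H2 where "H2 t z = complex_of_real (w t) * \<psi> (D (inverse t) z) * g z" for t z
  have [measurable]: "case_prod H2 \<in> borel_measurable (lborel \<Otimes>\<^sub>M lborel)"
    unfolding H2_def case_prod_unfold by measurable
  have K: "integrable (lborel \<Otimes>\<^sub>M lborel) (\<lambda>(t, z). w t * norm (g z))"
    by (rule lborel_pair.Fubini_integrable) (use ig iw w_nonneg in \<open>auto simp: case_prod_unfold\<close>)
  have H2P: "integrable (lborel \<Otimes>\<^sub>M lborel) (case_prod H2)"
  proof (rule Bochner_Integration.integrable_bound[OF integrable_mult_right[OF K, of B]])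
    have "norm (H2 t z) \<le> norm (B * (w t * norm (g z)))" for t z
    proof -
      have "norm (H2 t z) = (w t * norm (g z)) * norm (\<psi> (D (inverse t) z))"
        using w_nonneg[of t] by (simp add: H2_def norm_mult)
      also have "\<dots> \<le> (w t * norm (g z)) * B"
        using w_nonneg by (intro mult_left_mono B) auto
      finally show ?thesis
        using B0 w_nonneg[of t] by (simp add: abs_mult mult_ac)
    qed
    then show "AE p in lborel \<Otimes>\<^sub>M lborel. norm (case_prod H2 p)
        \<le> norm (B * (case p of (t, z) \<Rightarrow> w t * norm (g z)))"
      by (simp add: case_prod_unfold)
  qed measurable
  have S_eq: "g z * S z = (LINT t|lborel. H2 t z)" for z
  proof -
    have "S z = (LINT t|lborel. complex_of_real (w t) * \<psi> (D (inverse t) z))"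
      unfolding S_def set_lebesgue_integral_def
      by (rule Bochner_Integration.integral_cong) (auto simp: w_def indicator_def)
    then show ?thesis
      by (simp add: H2_def mult.commute)
  qed
  show "integrable lborel (\<lambda>z. g z * S z)"
    unfolding S_eq by (rule lborel_pair.integrable_snd[OF H2P])
  have A_eq: "average a g z * \<psi> z = (LINT t|lborel. H1 t z)" for z
  proof -
    have "average a g z = (LINT t|lborel. complex_of_real (w t / t ^ d) * g (D t z))"
      unfolding average_def set_lebesgue_integral_def
      by (rule Bochner_Integration.integral_cong) (auto simp: w_def indicator_def)
    then show ?thesis
      by (simp only: H1_def integral_mult_left_zero)
  qed
  have inner: "(LINT z|lborel. H1 t z) = (LINT z|lborel. H2 t z)" for t
  proof (cases "t \<in> {0<..<1}")
    case True
    then have t: "0 < t"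
      by simp
    \<comment> \<open>Chosen so that \<open>h (D t z)\<close> is \<open>H1 t z\<close>: by
      \<open>D_inverse\<close> the inner dilation undoes \<open>D t\<close> in the argument of
      \<open>\<psi>\<close>.\<close>
    define h where "h z = complex_of_real (w t / t ^ d) * g z * \<psi> (D (inverse t) z)" for z
    have "(LINT z|lborel. H1 t z) = (LINT z|lborel. h (D t z))"
      by (simp add: H1_def h_def D_inverse[OF t])
    also have "\<dots> = t ^ d *\<^sub>R (LINT z|lborel. h z)"
      by (rule integral_D[OF _ t]) (simp add: h_def[abs_def])
    also have "\<dots> = (LINT z|lborel. t ^ d *\<^sub>R h z)"
      by simp
    also have "\<dots> = (LINT z|lborel. H2 t z)"
      using t by (intro Bochner_Integration.integral_cong)
        (auto simp: h_def H2_def scaleR_conv_of_real)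
    finally show ?thesis .
  qed (simp add: H1_def H2_def w_def)
  show "(LINT z|lborel. average a g z * \<psi> z) = (LINT z|lborel. g z * S z)"
    unfolding A_eq S_eq
    by (simp add: lborel_pair.Fubini_integral[OF H1P] lborel_pair.Fubini_integral[OF H2P] inner)
qed

end

section \<open>Lebesgue measure under full and partial dilations\<close>

lemma distr_lborel_of_left_inverse:
  fixes T D :: "'a::euclidean_space \<Rightarrow> 'a"
  assumes T: "lborel = density (distr lborel borel T) (\<lambda>_. k)"
    and [measurable]: "T \<in> borel_measurable borel" "D \<in> borel_measurable borel"
    and inv: "\<And>z. D (T z) = z"
  shows "distr lborel borel D = density lborel (\<lambda>_. k)"
proof -
  \<comment> \<open>Scaling of Lebesgue measure is known for the multiplication \<open>T\<close>. A
    constant density commutes with pushforward, so a further pushforward along \<open>D\<close>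
    cancels \<open>T\<close> and isolates the image measure of \<open>D\<close>.\<close>
  have "lborel = distr (density lborel (\<lambda>_. k)) borel T"
    by (subst T, subst density_distr) auto
  then have "distr lborel borel D = distr (distr (density lborel (\<lambda>_. k)) borel T) borel D"
    by simp
  also have "\<dots> = distr (density lborel (\<lambda>_. k)) borel (D \<circ> T)"
    by (rule distr_distr) auto
  also have "D \<circ> T = (\<lambda>z. z)"
    using inv by auto
  also have "distr (density lborel (\<lambda>_. k)) borel (\<lambda>z. z) = density lborel (\<lambda>_. k)"
    by (rule measure_eqI) (auto simp: emeasure_distr)
  finally show ?thesis .
qed

lemma dilation_full: "dilation (\<lambda>t (x :: real ^ 'm::finite). x /\<^sub>R t) CARD('m)"
proof
  show "(\<lambda>p. snd p /\<^sub>R fst p :: real ^ 'm) \<in> borel_measurable (borel \<Otimes>\<^sub>M borel)"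
    by measurable
next
  fix t :: real
  assume t: "0 < t"
  have "lborel = density (distr lborel borel (\<lambda>x :: real ^ 'm. 0 + t *\<^sub>R x)) (\<lambda>_. ennreal (\<bar>t\<bar> ^ DIM(real ^ 'm)))"
    by (rule lborel_affine) (use t in auto)
  then have "lborel = density (distr lborel borel (\<lambda>x :: real ^ 'm. t *\<^sub>R x)) (\<lambda>_. ennreal (t ^ CARD('m)))"
    using t by simp
  then show "distr lborel borel (\<lambda>x :: real ^ 'm. x /\<^sub>R t) = density lborel (\<lambda>_. ennreal (t ^ CARD('m)))"
    by (rule distr_lborel_of_left_inverse) (use t in auto)
  show "(z /\<^sub>R t) /\<^sub>R inverse t = z" for z :: "real ^ 'm"
    using t by simp
qed

lemma dilation_snd:
  "dilation (\<lambda>t (z :: (real ^ 'm::finite) \<times> (real ^ 'n::finite)). (fst z, snd z /\<^sub>R t)) CARD('n)"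
proof
  show "(\<lambda>p. (fst (snd p), snd (snd p) /\<^sub>R fst p) :: (real ^ 'm) \<times> (real ^ 'n)) \<in>
      borel_measurable (borel \<Otimes>\<^sub>M borel)"
  proof -
    have f: "fst \<in> borel_measurable (borel :: ((real ^ 'm) \<times> (real ^ 'n)) measure)"
      and s: "snd \<in> borel_measurable (borel :: ((real ^ 'm) \<times> (real ^ 'n)) measure)"
      by (auto intro!: borel_measurable_continuous_onI continuous_intros)
    show ?thesis
      by (intro borel_measurable_Pair borel_measurable_scaleR borel_measurable_inverse measurable_fst
          measurable_compose[OF measurable_snd f] measurable_compose[OF measurable_snd s])
  qed
next
  fix t :: real
  assume t: "0 < t"
  \<comment> \<open>A basis vector of the product has first component 0 precisely when it comes from
    the second factor, so the diagonal map with entries \<open>c\<close> scales y by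
    \<open>t\<close> and fixes x.\<close>
  define c where "c j = (if fst j = 0 then t else 1)" for j :: "(real ^ 'm) \<times> (real ^ 'n)"
  let ?T = "\<lambda>z :: (real ^ 'm) \<times> (real ^ 'n). 0 + (\<Sum>j\<in>Basis. (c j * (z \<bullet> j)) *\<^sub>R j)"
  have T: "?T z = (fst z, t *\<^sub>R snd z)" for z
  proof (rule euclidean_eqI)
    fix b :: "(real ^ 'm) \<times> (real ^ 'n)"
    assume b: "b \<in> Basis"
    have "?T z \<bullet> b = c b * (z \<bullet> b)"
      unfolding add_0 by (rule inner_sum_left_Basis[OF b])
    also have "\<dots> = (fst z, t *\<^sub>R snd z) \<bullet> b"
      using b by (auto simp: Basis_prod_def c_def inner_prod_def)
    finally show "?T z \<bullet> b = (fst z, t *\<^sub>R snd z) \<bullet> b" .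
  qed
  have "(\<Prod>j\<in>Basis. \<bar>c j\<bar>) = t ^ CARD('n)"
  proof -
    have "(\<Prod>j\<in>Basis. \<bar>c j\<bar>) = (\<Prod>j\<in>(\<lambda>v. (0 :: real ^ 'm, v)) ` (Basis :: (real ^ 'n) set). t)"
      by (rule prod.mono_neutral_cong_right) (use t in \<open>auto simp: c_def Basis_prod_def\<close>)
    also have "\<dots> = t ^ CARD('n)"
      by (subst prod.reindex) (auto simp: inj_on_def)
    finally show ?thesis .
  qed
  moreover have "lborel = density (distr lborel borel ?T) (\<lambda>_. ennreal (\<Prod>j\<in>Basis. \<bar>c j\<bar>))"
    by (rule lborel_affine_euclidean) (use t in \<open>auto simp: c_def\<close>)
  ultimately have "lborel = density (distr lborel borel
      (\<lambda>z :: (real ^ 'm) \<times> (real ^ 'n). (fst z, t *\<^sub>R snd z)))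
      (\<lambda>_. ennreal (t ^ CARD('n)))"
    unfolding T by simp
  then show "distr lborel borel (\<lambda>z :: (real ^ 'm) \<times> (real ^ 'n). (fst z, snd z /\<^sub>R t)) =
      density lborel (\<lambda>_. ennreal (t ^ CARD('n)))"
  proof (rule distr_lborel_of_left_inverse)
    show "(\<lambda>z :: (real ^ 'm) \<times> (real ^ 'n). (fst z, t *\<^sub>R snd z)) \<in> borel_measurable borel"
      "(\<lambda>z :: (real ^ 'm) \<times> (real ^ 'n). (fst z, snd z /\<^sub>R t)) \<in> borel_measurable borel"
      by (auto intro!: borel_measurable_continuous_onI continuous_intros)
  qed (use t in auto)
  show "(fst (fst z, snd z /\<^sub>R t), snd (fst z, snd z /\<^sub>R t) /\<^sub>R inverse t) = z"
    for z :: "(real ^ 'm) \<times> (real ^ 'n)"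
    using t by simp
qed

section \<open>Compactly supported functions\<close>

lemma continuous_compact_support_bounded:
  fixes g :: "'a::t2_space \<Rightarrow> 'b::real_normed_vector"
  assumes "continuous_on UNIV g" "compact K" "\<And>z. z \<notin> K \<Longrightarrow> g z = 0"
  obtains B where "\<And>z. norm (g z) \<le> B"
proof -
  have "compact (g ` K)"
    using assms(1,2) by (blast intro: compact_continuous_image continuous_on_subset)
  then obtain B where "\<And>z. z \<in> K \<Longrightarrow> norm (g z) \<le> B"
    by (meson bounded_iff compact_imp_bounded imageI)
  then have "norm (g z) \<le> max B 0" for z
    using assms(3)[of z] by (cases "z \<in> K") (auto simp: max.coboundedI1)
  then show ?thesis
    by (rule that)
qed

lemma integrable_bounded_support:
  fixes g :: "'a::euclidean_space \<Rightarrow> 'b::{banach, second_countable_topology}"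
  assumes g: "g \<in> borel_measurable borel" and B: "\<And>z. norm (g z) \<le> B"
    and K: "compact K" "\<And>z. z \<notin> K \<Longrightarrow> g z = 0"
  shows "integrable lborel g"
proof (rule Bochner_Integration.integrable_bound)
  show "integrable lborel (\<lambda>z. B * indicator K z)"
    using K(1) by (auto intro!: integrable_real_indicator emeasure_compact_finite borel_compact)
  show "AE z in lborel. norm (g z) \<le> norm (B * indicator K z)"
    using K(2) order_trans[OF B abs_ge_self] by (auto simp: indicator_def)
qed (use g in simp)

lemma integrable_compact_support:
  fixes g :: "'a::euclidean_space \<Rightarrow> 'b::{banach, second_countable_topology}"
  assumes "continuous_on UNIV g" "compact K" "\<And>z. z \<notin> K \<Longrightarrow> g z = 0"
  shows "integrable lborel g"
proof -
  obtain B where "\<And>z. norm (g z) \<le> B"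
    using continuous_compact_support_bounded[OF assms] by metis
  then show ?thesis
    by (rule integrable_bounded_support[OF borel_measurable_continuous_onI[OF assms(1)] _ assms(2,3)])
qed

section \<open>Membership and comparison in L^p\<close>

lemma in_Lp_bounded_support:
  assumes [measurable]: "g \<in> borel_measurable borel" and B: "\<And>z. norm (g z) \<le> B"
    and K: "compact K" "\<And>z. z \<notin> K \<Longrightarrow> g z = 0" and p: "0 \<le> p"
  shows "in_Lp p g"
  unfolding in_Lp_def
proof (intro conjI integrable_bounded_support[OF _ _ K(1)])
  show "norm (norm (g z) powr p) \<le> B powr p" for z
    using p B by (simp add: powr_mono2)
qed (use K(2) in auto)

lemma Lp_mono:
  assumes h: "in_Lp p h" and g: "g \<in> borel_measurable borel"
    and le: "\<And>z. norm (g z) \<le> norm (h z)" and p: "0 < p"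
  shows "in_Lp p g" "Lp_norm p g \<le> Lp_norm p h"
proof -
  have ih: "integrable lborel (\<lambda>z. norm (h z) powr p)"
    using h by (simp add: in_Lp_def)
  have le': "norm (g z) powr p \<le> norm (h z) powr p" for z
    using le p by (intro powr_mono2) auto
  have ig: "integrable lborel (\<lambda>z. norm (g z) powr p)"
    by (rule Bochner_Integration.integrable_bound[OF ih]) (use g le' in auto)
  then show "in_Lp p g"
    using g by (simp add: in_Lp_def)
  show "Lp_norm p g \<le> Lp_norm p h"
    unfolding Lp_norm_def using p
    by (intro powr_mono2 Bochner_Integration.integral_mono ig ih le'
        Bochner_Integration.integral_nonneg) auto
qed

lemma Lp_cmult:
  assumes "in_Lp p g" and p: "0 < p"
  shows "in_Lp p (\<lambda>z. complex_of_real c * g z)"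
    and "Lp_norm p (\<lambda>z. complex_of_real c * g z) = \<bar>c\<bar> * Lp_norm p g"
proof -
  have eq: "norm (complex_of_real c * g z) powr p = \<bar>c\<bar> powr p * norm (g z) powr p" for z
    by (simp add: norm_mult powr_mult)
  show "in_Lp p (\<lambda>z. complex_of_real c * g z)"
    using assms(1) by (auto simp: in_Lp_def eq intro: borel_measurable_times)
  show "Lp_norm p (\<lambda>z. complex_of_real c * g z) = \<bar>c\<bar> * Lp_norm p g"
    using p by (simp add: Lp_norm_def eq powr_mult powr_powr)
qed

lemma abs_mi_pow_le: "\<bar>mi_pow x \<alpha>\<bar> \<le> norm x ^ mi_size \<alpha>"
proof -
  have "\<bar>mi_pow x \<alpha>\<bar> = (\<Prod>i\<in>UNIV. \<bar>x $ i\<bar> ^ \<alpha> i)"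
    by (simp add: mi_pow_def abs_prod power_abs)
  also have "\<dots> \<le> (\<Prod>i\<in>UNIV. norm x ^ \<alpha> i)"
    by (intro prod_mono conjI power_mono component_le_norm_cart) auto
  finally show ?thesis
    by (simp add: mi_size_def power_sum)
qed

lemma continuous_on_mi_pow [continuous_intros]:
  assumes "continuous_on S h"
  shows "continuous_on S (\<lambda>z. mi_pow (h z) \<alpha>)"
  unfolding mi_pow_def by (intro continuous_intros assms)

lemma measurable_mi_pow [measurable (raw)]:
  assumes [measurable]: "h \<in> borel_measurable N"
  shows "(\<lambda>z. mi_pow (h z) \<alpha>) \<in> borel_measurable N"
proof -
  have "(\<lambda>x. mi_pow x \<alpha>) \<in> borel_measurable borel"
    by (intro borel_measurable_continuous_onI continuous_intros)
  from measurable_compose[OF assms this] show ?thesis .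
qed

text \<open>The subcritical range is the positivity of the second Beta parameter, after clearing
  denominators. For \<open>d = 1\<close> the parameter is 1/p and the critical exponent is
  infinite.\<close>

lemma crit_exp_cond:
  assumes "1 \<le> p" "ereal p < crit_exp d" "0 < d"
  shows "0 < real d / p - real d + 1"
proof (cases "d = 1")
  case False
  then have d: "0 < real d - 1"
    using assms(3) by auto
  then have "p < real d / (real d - 1)"
    using assms(2) by (simp add: crit_exp_def)
  then have "p * (real d - 1) < real d"
    using d by (simp add: field_simps)
  then show ?thesis
    using assms(1) by (simp add: field_simps)
qed (use assms in auto)

text \<open>Supplies what is later asked of the moments of f over fibres. The bound is uniform in x
  because all fibres of the support lie in one compact set, the projection of \<open>K\<close> to
  the second factor.\<close>

lemma fiber_integral_compact_support:
  fixes g :: "'a::euclidean_space \<times> 'b::euclidean_space \<Rightarrow> 'c::{banach, second_countable_topology}"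
  assumes g: "continuous_on UNIV g" and K: "compact K" and supp: "{z. g z \<noteq> 0} \<subseteq> K"
  shows "(\<lambda>x. LINT y|lborel. g (x, y)) \<in> borel_measurable borel"
    and "\<exists>B. \<forall>x. norm (LINT y|lborel. g (x, y)) \<le> B"
    and "x \<notin> fst ` K \<Longrightarrow> (LINT y|lborel. g (x, y)) = 0"
    and "(LINT z|lborel. g z) = (LINT x|lborel. LINT y|lborel. g (x, y))"
proof -
  have K0: "g z = 0" if "z \<notin> K" for z
    using supp that by auto
  have meas: "g \<in> borel_measurable (borel \<Otimes>\<^sub>M lborel)"
    unfolding measurable_cong_sets[OF sets_pair_measure_cong[OF refl sets_lborel] refl] borel_prod
    by (rule borel_measurable_continuous_onI[OF g])
  then show "(\<lambda>x. LINT y|lborel. g (x, y)) \<in> borel_measurable borel"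
    by (intro lborel.borel_measurable_lebesgue_integral) simp
  obtain B where B: "\<And>z. norm (g z) \<le> B"
    using continuous_compact_support_bounded[OF g K K0] by metis
  have sndK: "compact (snd ` K)"
    using K by (intro compact_continuous_image continuous_intros)
  have "norm (LINT y|lborel. g (x, y)) \<le> (LINT y|lborel. B * indicator (snd ` K) y)" for x
  proof -
    have "norm (LINT y|lborel. g (x, y)) \<le> (LINT y|lborel. norm (g (x, y)))"
      by (rule integral_norm_bound)
    also have "\<dots> \<le> (LINT y|lborel. B * indicator (snd ` K) y)"
    proof (rule Bochner_Integration.integral_mono)
      have "g (x, y) = 0" if "y \<notin> snd ` K" for y
        using K0[of "(x, y)"] that by force
      moreover have "continuous_on UNIV (\<lambda>y. g (x, y))"
        by (rule continuous_on_compose2[OF g]) (auto intro!: continuous_intros)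
      ultimately show "integrable lborel (\<lambda>y. norm (g (x, y)))"
        by (intro integrable_norm integrable_compact_support[OF _ sndK])
      show "integrable lborel (\<lambda>y. B * indicator (snd ` K) y)"
        using sndK by (auto intro!: integrable_real_indicator emeasure_compact_finite borel_compact)
      show "norm (g (x, y)) \<le> B * indicator (snd ` K) y" for y
        using B[of "(x, y)"] K0[of "(x, y)"] by (force simp: indicator_def)
    qed
    finally show ?thesis .
  qed
  then show "\<exists>B. \<forall>x. norm (LINT y|lborel. g (x, y)) \<le> B"
    by blast
  show "(LINT y|lborel. g (x, y)) = 0" if "x \<notin> fst ` K"
  proof -
    have "g (x, y) = 0" for y
      using K0[of "(x, y)"] that by force
    then show ?thesis
      by simp
  qed
  show "(LINT z|lborel. g z) = (LINT x|lborel. LINT y|lborel. g (x, y))"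
    using lborel_pair.integral_fst'[of g] integrable_compact_support[OF g K K0]
    by (simp add: lborel_prod)
qed

section \<open>The remainder terms\<close>

interpretation dil_x: dilation "\<lambda>t (x :: real ^ 'm::finite). x /\<^sub>R t" "CARD('m)"
  by (rule dilation_full)

interpretation dil_y: dilation
  "\<lambda>t (z :: (real ^ 'm::finite) \<times> (real ^ 'n::finite)). (fst z, snd z /\<^sub>R t)" "CARD('n)"
  by (rule dilation_snd)

text \<open>Absorbing the monomial in y/t into the dilated function makes both the norm bound and
  the duality of \<open>average\<close> applicable. Oddness of \<open>k\<close> turns
  \<open>(k - 1) div 2\<close> into \<open>K - 1\<close> and (k + 1)/2 into the integer
  \<open>K\<close>.\<close>

lemma F_rem_eq:
  fixes f :: "(real ^ 'm::finite) \<times> (real ^ 'n::finite) \<Rightarrow> complex"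
  assumes "odd k" "K = (k + 1) div 2"
  shows "F_rem k \<gamma> f = (\<lambda>z. complex_of_real (real K / mi_fact \<gamma> * (- 1) ^ K) *
    dil_y.average K (\<lambda>z. complex_of_real (mi_pow (snd z) \<gamma>) * f z) z)"
proof
  fix z :: "(real ^ 'm) \<times> (real ^ 'n)"
  have k: "(k - 1) div 2 = K - 1" "real (k + 1) / 2 = real K"
    using assms by (auto elim!: oddE)
  show "F_rem k \<gamma> f z = complex_of_real (real K / mi_fact \<gamma> * (- 1) ^ K) *
    dil_y.average K (\<lambda>z. complex_of_real (mi_pow (snd z) \<gamma>) * f z) z"
    unfolding F_rem_def dil_y.average_def k assms(2)[symmetric] by (simp add: case_prod_unfold mult_ac)
qed

lemma R_rem_eq:
  fixes f :: "(real ^ 'm::finite) \<times> (real ^ 'n::finite) \<Rightarrow> complex"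
  shows "R_rem \<beta> \<gamma> f = (\<lambda>x. complex_of_real (real (mi_size \<beta>) / mi_fact \<beta> * (- 1) ^ mi_size \<beta>) *
    dil_x.average (mi_size \<beta>)
      (\<lambda>x. complex_of_real (mi_pow x \<beta>) * (LINT y|lborel. f (x, y) * complex_of_real (mi_pow y \<gamma>))) x)"
  unfolding R_rem_def dil_x.average_def by (simp add: mult_ac)

text \<open>The prefactor K/\<gamma>! times the constant of \<open>average_Lp\<close> is
  \<open>dilation_const\<close>, and |y^\<gamma>| \<le> |y|^K passes to the stated weight. Only y is
  dilated, so n alone enters the exponent.\<close>

lemma F_rem_Lp:
  fixes f :: "(real ^ 'm::finite) \<times> (real ^ 'n::finite) \<Rightarrow> complex"
  assumes k: "odd k" and f: "test_function f" and p: "1 \<le> p" "ereal p < crit_exp CARD('n)"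
    and \<gamma>: "mi_size \<gamma> = (k + 1) div 2"
  shows "in_Lp p (F_rem k \<gamma> f)"
    and "Lp_norm p (F_rem k \<gamma> f) \<le> dilation_const p \<gamma> *
      Lp_norm p (\<lambda>(x, y). complex_of_real (norm y ^ ((k + 1) div 2)) * f (x, y))"
proof -
  define K where "K = (k + 1) div 2"
  have K0: "0 < K"
    using k by (auto simp: K_def elim!: oddE)
  obtain S where S: "compact S" "\<And>z. z \<notin> S \<Longrightarrow> f z = 0"
    using test_function_support[OF f] by metis
  note cf = smooth_imp_continuous[OF test_function_smooth[OF f]]
  define g where "g z = complex_of_real (mi_pow (snd z) \<gamma>) * f z" for z
  define G where "G z = complex_of_real (norm (snd z) ^ K) * f z" for z
  have cG: "continuous_on UNIV G" and cg: "continuous_on UNIV g"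
    unfolding G_def[abs_def] g_def[abs_def] by (intro continuous_intros cf)+
  obtain B where "\<And>z. norm (G z) \<le> B"
    using continuous_compact_support_bounded[OF cG S(1)] S(2) by (force simp: G_def)
  then have G: "in_Lp p G"
    by (rule in_Lp_bounded_support[OF borel_measurable_continuous_onI[OF cG] _ S(1)])
      (use S(2) p in \<open>auto simp: G_def\<close>)
  have le: "norm (g z) \<le> norm (G z)" for z
    using abs_mi_pow_le[of "snd z" \<gamma>] \<gamma>
    by (auto simp: g_def G_def norm_mult norm_power K_def intro!: mult_right_mono)
  have g: "in_Lp p g" "Lp_norm p g \<le> Lp_norm p G"
    using Lp_mono[OF G borel_measurable_continuous_onI[OF cg] le] p by auto
  note ave = dil_y.average_Lp[OF g(1) p(1) K0 crit_exp_cond[OF p zero_less_card_finite]]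
  have F: "F_rem k \<gamma> f = (\<lambda>z. complex_of_real (real K / mi_fact \<gamma> * (- 1) ^ K) * dil_y.average K g z)"
    using F_rem_eq[OF k K_def] by (simp add: g_def[abs_def])
  have p0: "0 < p"
    using p by simp
  show "in_Lp p (F_rem k \<gamma> f)"
    unfolding F by (rule Lp_cmult(1)[OF ave(1) p0])
  have "Lp_norm p (F_rem k \<gamma> f) = real K / mi_fact \<gamma> * Lp_norm p (dil_y.average K g)"
    unfolding F Lp_cmult(2)[OF ave(1) p0] using mi_fact_pos[of \<gamma>] by (simp add: abs_mult power_abs)
  also have "\<dots> \<le> real K / mi_fact \<gamma> * (Beta (real K) (real CARD('n) / p - real CARD('n) + 1) * Lp_norm p g)"
    using mi_fact_pos[of \<gamma>] by (intro mult_left_mono ave(2)) auto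
  also have "\<dots> = dilation_const p \<gamma> * Lp_norm p g"
    using \<gamma> by (simp add: dilation_const_def K_def)
  also have "\<dots> \<le> dilation_const p \<gamma> * Lp_norm p G"
  proof (intro mult_left_mono g(2))
    have "0 < Beta (real K) (real CARD('n) / p - real CARD('n) + 1)"
      unfolding Beta_def using K0 crit_exp_cond[OF p zero_less_card_finite]
      by (intro divide_pos_pos mult_pos_pos Gamma_real_pos) auto
    then show "0 \<le> dilation_const p \<gamma>"
      using \<gamma> mi_fact_pos[of \<gamma>] by (simp add: dilation_const_def K_def)
  qed
  finally show "Lp_norm p (F_rem k \<gamma> f) \<le> dilation_const p \<gamma> *
      Lp_norm p (\<lambda>(x, y). complex_of_real (norm y ^ ((k + 1) div 2)) * f (x, y))"
    by (simp add: G_def[abs_def] K_def case_prod_unfold)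
qed

text \<open>The averaged function is x^\<beta> times the \<gamma>-moment of f. It is dominated by
  |x|^|\<beta>| times the fibre integral of |y|^|\<gamma>| |f|, whose L^p norm is exactly the mixed
  norm.\<close>

lemma R_rem_Lp:
  fixes f :: "(real ^ 'm::finite) \<times> (real ^ 'n::finite) \<Rightarrow> complex"
  assumes f: "test_function f" and p: "1 \<le> p" "ereal p < crit_exp CARD('m)"
    and \<beta>: "0 < mi_size \<beta>"
  shows "in_Lp p (R_rem \<beta> \<gamma> f)"
    and "Lp_norm p (R_rem \<beta> \<gamma> f) \<le> dilation_const p \<beta> * mixed_norm p (mi_size \<beta>) (mi_size \<gamma>) f"
proof -
  define a where "a = mi_size \<beta>"
  obtain S where S: "compact S" "\<And>z. z \<notin> S \<Longrightarrow> f z = 0"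
    using test_function_support[OF f] by metis
  note cf = smooth_imp_continuous[OF test_function_smooth[OF f]]
  define u where "u z = f z * complex_of_real (mi_pow (snd z) \<gamma>)" for z
  define v where "v z = norm (snd z) ^ mi_size \<gamma> * norm (f z)" for z
  have cu: "continuous_on UNIV u" and cv: "continuous_on UNIV v"
    unfolding u_def[abs_def] v_def[abs_def] by (intro continuous_intros cf)+
  have uS: "{z. u z \<noteq> 0} \<subseteq> S" and vS: "{z. v z \<noteq> 0} \<subseteq> S"
    using S(2) by (auto simp: u_def v_def)
  note u = fiber_integral_compact_support[OF cu S(1) uS]
  note v = fiber_integral_compact_support[OF cv S(1) vS]
  define m where "m x = (LINT y|lborel. v (x, y))" for x
  have m0: "0 \<le> m x" for x
    unfolding m_def by (rule Bochner_Integration.integral_nonneg) (simp add: v_def)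
  have um: "norm (LINT y|lborel. u (x, y)) \<le> m x" for x
  proof -
    have sndS: "compact (snd ` S)"
      using S(1) by (intro compact_continuous_image continuous_intros)
    have S0: "f (x, y) = 0" if "y \<notin> snd ` S" for y
      using S(2)[of "(x, y)"] that by force
    have "continuous_on UNIV (\<lambda>y. u (x, y))" "continuous_on UNIV (\<lambda>y. v (x, y))"
      by (rule continuous_on_compose2[OF cu] continuous_on_compose2[OF cv], auto intro!: continuous_intros)+
    then have int: "integrable lborel (\<lambda>y. u (x, y))" "integrable lborel (\<lambda>y. v (x, y))"
      by (auto intro!: integrable_compact_support[OF _ sndS] simp: u_def v_def S0)
    have "norm (LINT y|lborel. u (x, y)) \<le> (LINT y|lborel. norm (u (x, y)))"
      by (rule integral_norm_bound)
    also have "\<dots> \<le> m x"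
      unfolding m_def
    proof (rule Bochner_Integration.integral_mono)
      show "norm (u (x, y)) \<le> v (x, y)" for y
        using mult_left_mono[OF abs_mi_pow_le[of y \<gamma>], of "norm (f (x, y))"]
        by (simp add: u_def v_def norm_mult mult.commute)
    qed (use int in auto)
    finally show ?thesis .
  qed
  define g where "g x = complex_of_real (mi_pow x \<beta>) * (LINT y|lborel. u (x, y))" for x
  define G where "G x = complex_of_real (norm x ^ a * m x)" for x
  have mG [measurable]: "G \<in> borel_measurable borel" and mg: "g \<in> borel_measurable borel"
    using u(1) v(1) unfolding G_def[abs_def] g_def[abs_def] m_def by measurable
  obtain B where B: "\<And>x. m x \<le> B"
    using v(2) unfolding m_def real_norm_def by (metis abs_le_D1)
  have fstS: "compact (fst ` S)"
    using S(1) by (intro compact_continuous_image continuous_intros)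
  have G0: "G x = 0" if "x \<notin> fst ` S" for x
    using v(3)[OF that] by (simp add: G_def m_def)
  obtain r where r: "\<And>x. x \<in> fst ` S \<Longrightarrow> norm x \<le> r"
    using compact_imp_bounded[OF fstS] by (auto simp: bounded_iff)
  have B0: "0 \<le> B"
    using m0 B order_trans by blast
  have "norm (G x) \<le> \<bar>r\<bar> ^ a * B" for x
  proof (cases "x \<in> fst ` S")
    case True
    then have "norm x \<le> \<bar>r\<bar>"
      using r[OF True] by linarith
    then have "norm x ^ a * m x \<le> \<bar>r\<bar> ^ a * B"
      using m0 B B0 by (intro mult_mono power_mono) auto
    then show ?thesis
      using m0[of x] by (simp add: G_def norm_mult norm_power)
  qed (use G0 B0 in auto)
  then have G: "in_Lp p G"
    by (rule in_Lp_bounded_support[OF mG _ fstS]) (use G0 p in auto)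
  have le: "norm (g x) \<le> norm (G x)" for x
  proof -
    have "\<bar>mi_pow x \<beta>\<bar> * norm (LINT y|lborel. u (x, y)) \<le> norm x ^ a * m x"
      unfolding a_def by (intro mult_mono abs_mi_pow_le um) auto
    then show ?thesis
      using m0[of x] by (simp add: g_def G_def norm_mult norm_power)
  qed
  have p0: "0 < p"
    using p by simp
  have g: "in_Lp p g" "Lp_norm p g \<le> Lp_norm p G"
    using Lp_mono[OF G mg le p0] by auto
  have mixed: "mixed_norm p a (mi_size \<gamma>) f = Lp_norm p G"
  proof -
    have "norm x powr (p * real a) * m x powr p = norm (G x) powr p" for x
    \<comment> \<open>At the origin both sides are 0: the left since a \<open>powr\<close> with base
      0 is 0, the right since \<open>0 ^ a = 0\<close> for \<open>a > 0\<close>.\<close>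
    proof (cases "x = 0")
      case False
      then have "norm x powr (p * real a) = (norm x ^ a) powr p"
        by (simp add: powr_powr mult.commute flip: powr_realpow)
      then show ?thesis
        using m0[of x] by (simp add: G_def norm_mult norm_power powr_mult)
    qed (use \<beta> in \<open>simp add: G_def a_def\<close>)
    then show ?thesis
      by (simp add: mixed_norm_def Lp_norm_def m_def v_def)
  qed
  have a0: "0 < a"
    using \<beta> by (simp add: a_def)
  note ave = dil_x.average_Lp[OF g(1) p(1) a0 crit_exp_cond[OF p zero_less_card_finite]]
  have R: "R_rem \<beta> \<gamma> f = (\<lambda>z. complex_of_real (real a / mi_fact \<beta> * (- 1) ^ a) * dil_x.average a g z)"
    using R_rem_eq[of \<beta> \<gamma> f] by (simp add: g_def[abs_def] u_def a_def)
  show "in_Lp p (R_rem \<beta> \<gamma> f)"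
    unfolding R by (rule Lp_cmult(1)[OF ave(1) p0])
  have "Lp_norm p (R_rem \<beta> \<gamma> f) = real a / mi_fact \<beta> * Lp_norm p (dil_x.average a g)"
    unfolding R Lp_cmult(2)[OF ave(1) p0] using mi_fact_pos[of \<beta>] by (simp add: abs_mult power_abs)
  also have "\<dots> \<le> real a / mi_fact \<beta> * (Beta (real a) (real CARD('m) / p - real CARD('m) + 1) * Lp_norm p g)"
    using mi_fact_pos[of \<beta>] by (intro mult_left_mono ave(2)) auto
  also have "\<dots> = dilation_const p \<beta> * Lp_norm p g"
    by (simp add: dilation_const_def a_def)
  also have "\<dots> \<le> dilation_const p \<beta> * Lp_norm p G"
  proof (intro mult_left_mono g(2))
    have "0 < Beta (real a) (real CARD('m) / p - real CARD('m) + 1)"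
      unfolding Beta_def using a0 crit_exp_cond[OF p zero_less_card_finite]
      by (intro divide_pos_pos mult_pos_pos Gamma_real_pos) auto
    then show "0 \<le> dilation_const p \<beta>"
      using mi_fact_pos[of \<beta>] by (simp add: dilation_const_def a_def)
  qed
  finally show "Lp_norm p (R_rem \<beta> \<gamma> f) \<le> dilation_const p \<beta> * mixed_norm p (mi_size \<beta>) (mi_size \<gamma>) f"
    by (simp add: mixed flip: a_def)
qed

section \<open>The expansion of the distribution\<close>

text \<open>Taylor in y about (x, 0). The polynomial terms do not decay in y; they are integrable
  because f has compact support. The remainder is transferred to f by
  \<open>average_duality\<close>.\<close>

lemma expansion_snd:
  fixes f \<phi> :: "(real ^ 'm::finite) \<times> (real ^ 'n::finite) \<Rightarrow> complex"
  assumes f: "test_function f" and \<phi>: "test_function \<phi>" and K: "0 < K"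
  shows "distr_of_fun f \<phi> =
    (\<Sum>\<gamma> | mi_size \<gamma> < K. complex_of_real (1 / mi_fact \<gamma>) *
       (LINT z|lborel. f z * complex_of_real (mi_pow (snd z) \<gamma>) * mi_deriv ydir \<gamma> \<phi> (fst z, 0))) +
    (\<Sum>\<gamma> | mi_size \<gamma> = K. complex_of_real (real K / mi_fact \<gamma>) *
       (LINT z|lborel. dil_y.average K (\<lambda>z. complex_of_real (mi_pow (snd z) \<gamma>) * f z) z *
          mi_deriv ydir \<gamma> \<phi> z))"
proof -
  obtain S where S: "compact S" "\<And>z. z \<notin> S \<Longrightarrow> f z = 0"
    using test_function_support[OF f] by metis
  obtain T where T: "compact T" "\<And>\<gamma> z. z \<notin> T \<Longrightarrow> mi_deriv ydir \<gamma> \<phi> z = 0"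
    using test_function_support[OF \<phi>] by metis
  note cf = smooth_imp_continuous[OF test_function_smooth[OF f]]
  note sm = test_function_smooth[OF \<phi>]
  have c\<psi>: "continuous_on A (mi_deriv ydir \<gamma> \<phi>)" for A \<gamma>
    by (rule smooth_imp_continuous[OF smooth_mi_deriv[OF sm ydir_Basis]])
  define g where "g \<gamma> z = complex_of_real (mi_pow (snd z) \<gamma>) * f z" for \<gamma> :: "'n \<Rightarrow> nat" and z
  \<comment> \<open>The point \<open>snd z /\<^sub>R inverse s\<close> is
    \<open>s *\<^sub>R snd z\<close>, written as an inverse dilation to match
    \<open>average_duality\<close>.\<close>
  define R where "R \<gamma> z = (LINT s:{0<..<1}|lborel. complex_of_real ((1 - s) ^ (K - 1)) *
      mi_deriv ydir \<gamma> \<phi> (fst z, snd z /\<^sub>R inverse s))" for \<gamma> z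
  have taylor: "f z * \<phi> z =
      (\<Sum>\<gamma> | mi_size \<gamma> < K. complex_of_real (1 / mi_fact \<gamma>) *
        (f z * complex_of_real (mi_pow (snd z) \<gamma>) * mi_deriv ydir \<gamma> \<phi> (fst z, 0))) +
      (\<Sum>\<gamma> | mi_size \<gamma> = K. complex_of_real (real K / mi_fact \<gamma>) * (g \<gamma> z * R \<gamma> z))" for z
    using taylor_mi[where e = ydir and z = "(fst z, 0)" and c = "snd z" and v = "(0, snd z)",
        OF sm ydir_Basis K sum_ydir[symmetric]]
    by (simp add: R_def g_def distrib_left sum_distrib_left mult_ac)
  have int1: "integrable lborel (\<lambda>z. f z * complex_of_real (mi_pow (snd z) \<gamma>) *
      mi_deriv ydir \<gamma> \<phi> (fst z, 0))" for \<gamma>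
    by (rule integrable_compact_support[OF _ S(1)])
      (use S(2) in \<open>auto intro!: continuous_intros cf continuous_on_compose2[OF c\<psi>[of UNIV]]\<close>)
  have ig: "integrable lborel (g \<gamma>)" for \<gamma>
    unfolding g_def[abs_def]
    by (rule integrable_compact_support[OF _ S(1)])
      (use S(2) in \<open>auto intro!: continuous_intros cf\<close>)
  have dual: "integrable lborel (\<lambda>z. g \<gamma> z * R \<gamma> z) \<and>
      (LINT z|lborel. dil_y.average K (g \<gamma>) z * mi_deriv ydir \<gamma> \<phi> z) =
      (LINT z|lborel. g \<gamma> z * R \<gamma> z)" for \<gamma>
  proof -
    obtain B where "\<And>z. norm (mi_deriv ydir \<gamma> \<phi> z) \<le> B"
      using continuous_compact_support_bounded[OF c\<psi> T(1)] T(2) by metis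
    from dil_y.average_duality[OF ig borel_measurable_continuous_onI[OF c\<psi>] this]
    show ?thesis
      by (auto simp: R_def)
  qed
  have "distr_of_fun f \<phi> = (LINT z|lborel. f z * \<phi> z)"
    by (simp add: distr_of_fun_def)
  also have "\<dots> = (\<Sum>\<gamma> | mi_size \<gamma> < K. complex_of_real (1 / mi_fact \<gamma>) *
       (LINT z|lborel. f z * complex_of_real (mi_pow (snd z) \<gamma>) * mi_deriv ydir \<gamma> \<phi> (fst z, 0))) +
    (\<Sum>\<gamma> | mi_size \<gamma> = K. complex_of_real (real K / mi_fact \<gamma>) * (LINT z|lborel. g \<gamma> z * R \<gamma> z))"
    unfolding taylor using int1 dual
    by (subst Bochner_Integration.integral_add)
      (auto intro!: Bochner_Integration.integrable_sum integrable_mult_right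
        simp: Bochner_Integration.integral_sum simp del: of_real_divide)
  finally show ?thesis
    using dual by (simp add: g_def[abs_def])
qed

text \<open>Meant for \<open>\<eta>\<close> a y-derivative of the test function and \<open>h\<close>
  the corresponding y-moment of f. Differentiating along \<open>xdir\<close> at points (x, 0) of the
  product avoids treating the slice as a separate smooth function.\<close>

lemma expansion_fst:
  fixes \<eta> :: "(real ^ 'm::finite) \<times> (real ^ 'n::finite) \<Rightarrow> complex" and h :: "real ^ 'm \<Rightarrow> complex"
  assumes sm: "smooth \<eta>" and T: "compact T" "\<And>\<beta> z. z \<notin> T \<Longrightarrow> mi_deriv xdir \<beta> \<eta> z = 0"
    and ih: "\<And>\<beta>. integrable lborel (\<lambda>x. complex_of_real (mi_pow x \<beta>) * h x)" and M: "0 < M"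
  shows "(LINT x|lborel. h x * \<eta> (x, 0)) =
    (\<Sum>\<beta> | mi_size \<beta> < M. complex_of_real (1 / mi_fact \<beta>) *
       (LINT x|lborel. complex_of_real (mi_pow x \<beta>) * h x) * mi_deriv xdir \<beta> \<eta> 0) +
    (\<Sum>\<beta> | mi_size \<beta> = M. complex_of_real (real M / mi_fact \<beta>) *
       (LINT x|lborel. dil_x.average M (\<lambda>x. complex_of_real (mi_pow x \<beta>) * h x) x *
          mi_deriv xdir \<beta> \<eta> (x, 0)))"
proof -
  have c\<psi>: "continuous_on A (mi_deriv xdir \<beta> \<eta>)" for A \<beta>
    by (rule smooth_imp_continuous[OF smooth_mi_deriv[OF sm xdir_Basis]])
  define g where "g \<beta> x = complex_of_real (mi_pow x \<beta>) * h x" for \<beta> :: "'m \<Rightarrow> nat" and x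
  define R where "R \<beta> x = (LINT s:{0<..<1}|lborel. complex_of_real ((1 - s) ^ (M - 1)) *
      mi_deriv xdir \<beta> \<eta> (x /\<^sub>R inverse s, 0))" for \<beta> x
  have taylor: "h x * \<eta> (x, 0) =
      (\<Sum>\<beta> | mi_size \<beta> < M. complex_of_real (1 / mi_fact \<beta>) * mi_deriv xdir \<beta> \<eta> 0 * g \<beta> x) +
      (\<Sum>\<beta> | mi_size \<beta> = M. complex_of_real (real M / mi_fact \<beta>) * (g \<beta> x * R \<beta> x))" for x
    using taylor_mi[where e = xdir and z = 0 and c = x and v = "(x, 0)",
        OF sm xdir_Basis M sum_xdir[symmetric]]
    by (simp add: R_def g_def distrib_left sum_distrib_left mult_ac)
  have ig: "integrable lborel (g \<beta>)" for \<beta>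
    using ih by (simp add: g_def[abs_def])
  have dual: "integrable lborel (\<lambda>x. g \<beta> x * R \<beta> x) \<and>
      (LINT x|lborel. dil_x.average M (g \<beta>) x * mi_deriv xdir \<beta> \<eta> (x, 0)) =
      (LINT x|lborel. g \<beta> x * R \<beta> x)" for \<beta>
  proof -
    obtain B where B: "\<And>z. norm (mi_deriv xdir \<beta> \<eta> z) \<le> B"
      using continuous_compact_support_bounded[OF c\<psi> T(1)] T(2) by metis
    have "continuous_on UNIV (\<lambda>x. mi_deriv xdir \<beta> \<eta> (x, 0))"
      by (rule continuous_on_compose2[OF c\<psi>[of UNIV]]) (auto intro!: continuous_intros)
    from dil_x.average_duality[OF ig borel_measurable_continuous_onI[OF this] B]
    show ?thesis
      by (auto simp: R_def)
  qed
  have "(LINT x|lborel. h x * \<eta> (x, 0)) = (\<Sum>\<beta> | mi_size \<beta> < M.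
       complex_of_real (1 / mi_fact \<beta>) * mi_deriv xdir \<beta> \<eta> 0 * (LINT x|lborel. g \<beta> x)) +
    (\<Sum>\<beta> | mi_size \<beta> = M. complex_of_real (real M / mi_fact \<beta>) * (LINT x|lborel. g \<beta> x * R \<beta> x))"
    unfolding taylor using ig dual
    by (subst Bochner_Integration.integral_add)
      (auto intro!: Bochner_Integration.integrable_sum integrable_mult_right
        simp: Bochner_Integration.integral_sum simp del: of_real_divide)
  then show ?thesis
    using dual by (simp add: g_def[abs_def] mult_ac)
qed

text \<open>The derivative of the Dirac mass yields a y-derivative at y = 0 with the sign
  (-1)^|\<gamma>|. That sign sits inside the function on which the x-derivative acts, hence the
  constant \<open>c\<close> in \<open>mi_deriv_compose_affine\<close>.\<close>

lemma tensor_remainder: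
  fixes \<phi> :: "(real ^ 'm::finite) \<times> (real ^ 'n::finite) \<Rightarrow> complex"
  assumes sm: "smooth \<phi>"
  shows "distr_tensor (distr_deriv coord \<beta> (distr_of_fun G)) (distr_deriv coord \<gamma> dirac) \<phi> =
    (- 1) ^ (mi_size \<beta> + mi_size \<gamma>) *
      (LINT x|lborel. G x * mi_deriv xdir \<beta> (mi_deriv ydir \<gamma> \<phi>) (x, 0))"
proof -
  have y: "mi_deriv coord \<gamma> (\<lambda>y. \<phi> (x, y)) 0 = mi_deriv ydir \<gamma> \<phi> (x, 0)" for x
  proof -
    have "bounded_linear (\<lambda>y :: real ^ 'n. (0 :: real ^ 'm, y))"
      by (intro bounded_linear_Pair bounded_linear_zero bounded_linear_ident)
    from mi_deriv_compose_affine[where e = ydir and c = 1 and w = "(x, 0)" and \<alpha> = \<gamma>, OF sm ydir_Basis this]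
    show ?thesis
      by (simp add: coord_def ydir_def fun_eq_iff)
  qed
  have "bounded_linear (\<lambda>x :: real ^ 'm. (x, 0 :: real ^ 'n))"
    by (intro bounded_linear_Pair bounded_linear_zero bounded_linear_ident)
  from mi_deriv_compose_affine[where e = xdir and c = "(- 1) ^ mi_size \<gamma>" and w = 0 and \<alpha> = \<beta>,
      OF smooth_mi_deriv[OF sm ydir_Basis, where \<alpha> = \<gamma>] xdir_Basis this]
  have x: "mi_deriv coord \<beta> (\<lambda>x. (- 1) ^ mi_size \<gamma> * mi_deriv ydir \<gamma> \<phi> (x, 0)) =
      (\<lambda>x. (- 1) ^ mi_size \<gamma> * mi_deriv xdir \<beta> (mi_deriv ydir \<gamma> \<phi>) (x, 0))"
    by (simp add: coord_def xdir_def)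
  have "(LINT x|lborel. G x * (c * u x)) = c * (LINT x|lborel. G x * u x)" for c :: complex and u
    by (simp add: mult.left_commute)
  then show ?thesis
    by (simp only: distr_tensor_def distr_deriv_def dirac_def distr_of_fun_def x y power_add mult.assoc)
qed

text \<open>Moving the derivatives onto the test function reverses their order;
  \<open>mi_deriv_commute\<close> restores the order that the expansion uses.\<close>

lemma distr_deriv_xy_dirac:
  assumes "smooth \<phi>"
  shows "distr_deriv xdir \<beta> (distr_deriv ydir \<gamma> dirac) \<phi> =
    (- 1) ^ (mi_size \<beta> + mi_size \<gamma>) * mi_deriv xdir \<beta> (mi_deriv ydir \<gamma> \<phi>) 0"
  by (simp add: distr_deriv_def dirac_def power_add
      mi_deriv_commute[OF assms xdir_Basis ydir_Basis])

text \<open>The two Taylor expansions contain no signs. Each power of -1 in a coefficient or in the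
  prefactor of a remainder meets the same power from a distributional derivative; what is left is
  regrouping of sums.\<close>

lemma distr_of_fun_expansion:
  fixes f \<phi> :: "(real ^ 'm::finite) \<times> (real ^ 'n::finite) \<Rightarrow> complex"
  assumes k: "odd k" and f: "test_function f" and \<phi>: "test_function \<phi>"
  shows "distr_of_fun f \<phi> =
        (\<Sum>(\<beta>, \<gamma>) \<in> {(\<beta> :: 'm \<Rightarrow> nat, \<gamma> :: 'n \<Rightarrow> nat). mi_size \<beta> + 2 * mi_size \<gamma> \<le> k}.
           complex_of_real ((- 1) ^ (mi_size \<beta> + mi_size \<gamma>) / (mi_fact \<beta> * mi_fact \<gamma>)) *
           (LINT (x, y)|lborel. f (x, y) * complex_of_real (mi_pow x \<beta> * mi_pow y \<gamma>)) *
           distr_deriv xdir \<beta> (distr_deriv ydir \<gamma> dirac) \<phi>)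
      + (\<Sum>\<gamma> \<in> {\<gamma> :: 'n \<Rightarrow> nat. mi_size \<gamma> \<le> (k - 1) div 2}.
           \<Sum>\<beta> \<in> {\<beta> :: 'm \<Rightarrow> nat. mi_size \<beta> + 2 * mi_size \<gamma> = k + 1}.
             complex_of_real ((- 1) ^ mi_size \<gamma> / mi_fact \<gamma>) *
             distr_tensor (distr_deriv coord \<beta> (distr_of_fun (R_rem \<beta> \<gamma> f)))
                          (distr_deriv coord \<gamma> dirac) \<phi>)
      + (\<Sum>\<gamma> \<in> {\<gamma> :: 'n \<Rightarrow> nat. mi_size \<gamma> = (k + 1) div 2}.
           distr_deriv ydir \<gamma> (distr_of_fun (F_rem k \<gamma> f)) \<phi>)"
proof -
  define K where "K = (k + 1) div 2"
  have K0: "0 < K" and k_eq: "k + 1 = 2 * K"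
    using k by (auto simp: K_def elim!: oddE)
  note cf = smooth_imp_continuous[OF test_function_smooth[OF f]]
  note sm = test_function_smooth[OF \<phi>]
  obtain S where S: "compact S" "\<And>z. z \<notin> S \<Longrightarrow> f z = 0"
    using test_function_support[OF f] by metis
  obtain T where T: "compact T" "\<And>\<gamma> z. z \<notin> T \<Longrightarrow> mi_deriv ydir \<gamma> \<phi> z = 0"
    using test_function_support[OF \<phi>] by metis
  define h where "h \<gamma> x = (LINT y|lborel. f (x, y) * complex_of_real (mi_pow y \<gamma>))"
    for \<gamma> :: "'n \<Rightarrow> nat" and x
  define mom where "mom \<beta> \<gamma> = (LINT (x, y)|lborel. f (x, y) * complex_of_real (mi_pow x \<beta> * mi_pow y \<gamma>))"
    for \<beta> :: "'m \<Rightarrow> nat" and \<gamma> :: "'n \<Rightarrow> nat"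
  define \<psi> where "\<psi> \<gamma> = mi_deriv ydir \<gamma> \<phi>" for \<gamma> :: "'n \<Rightarrow> nat"
  have sm\<psi>: "smooth (\<psi> \<gamma>)" for \<gamma>
    unfolding \<psi>_def by (rule smooth_mi_deriv[OF sm ydir_Basis])
  \<comment> \<open>By Fubini the x-moments of the fibre moments \<open>h\<close> are the full
    moments of f.\<close>
  have weighted: "integrable lborel (\<lambda>x. complex_of_real (mi_pow x \<beta>) * h \<gamma> x) \<and>
      (LINT x|lborel. complex_of_real (mi_pow x \<beta>) * h \<gamma> x) = mom \<beta> \<gamma>" for \<beta> \<gamma>
  proof -
    define g where "g z = f z * complex_of_real (mi_pow (fst z) \<beta> * mi_pow (snd z) \<gamma>)" for z
    have cg: "continuous_on UNIV g"
      unfolding g_def[abs_def] by (intro continuous_intros cf)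
    have gS: "{z. g z \<noteq> 0} \<subseteq> S"
      using S(2) by (auto simp: g_def)
    have inner: "(LINT y|lborel. g (x, y)) = complex_of_real (mi_pow x \<beta>) * h \<gamma> x" for x
    proof -
      have "(LINT y|lborel. g (x, y)) =
          (LINT y|lborel. complex_of_real (mi_pow x \<beta>) * (f (x, y) * complex_of_real (mi_pow y \<gamma>)))"
        by (simp add: g_def mult_ac)
      then show ?thesis
        by (simp add: h_def)
    qed
    note fib = fiber_integral_compact_support[OF cg S(1) gS, unfolded inner]
    have "compact (fst ` S)"
      using S(1) by (intro compact_continuous_image continuous_intros)
    then have "integrable lborel (\<lambda>x. complex_of_real (mi_pow x \<beta>) * h \<gamma> x)"
      using fib(2) by (auto intro: integrable_bounded_support[OF fib(1) _ _ fib(3)])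
    moreover have "mom \<beta> \<gamma> = (LINT z|lborel. g z)"
      by (simp add: mom_def g_def case_prod_unfold)
    ultimately show ?thesis
      using fib(4) by simp
  qed
  have slice: "(LINT z|lborel. f z * complex_of_real (mi_pow (snd z) \<gamma>) * \<psi> \<gamma> (fst z, 0)) =
      (LINT x|lborel. h \<gamma> x * \<psi> \<gamma> (x, 0))" for \<gamma>
  proof -
    define g where "g z = f z * complex_of_real (mi_pow (snd z) \<gamma>) * \<psi> \<gamma> (fst z, 0)" for z
    have cg: "continuous_on UNIV g"
      unfolding g_def[abs_def]
      by (intro continuous_intros cf continuous_on_compose2[OF smooth_imp_continuous[OF sm\<psi>, of UNIV]]) auto
    have gS: "{z. g z \<noteq> 0} \<subseteq> S"
      using S(2) by (auto simp: g_def)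
    show ?thesis
      using fiber_integral_compact_support(4)[OF cg S(1) gS] by (simp add: g_def h_def)
  qed
  define A where "A \<gamma> \<beta> = complex_of_real (1 / (mi_fact \<beta> * mi_fact \<gamma>)) * mom \<beta> \<gamma> * mi_deriv xdir \<beta> (\<psi> \<gamma>) 0"
    for \<gamma> \<beta>
  define Rt where "Rt \<gamma> \<beta> = complex_of_real ((- 1) ^ mi_size \<gamma> / mi_fact \<gamma>) *
      distr_tensor (distr_deriv coord \<beta> (distr_of_fun (R_rem \<beta> \<gamma> f))) (distr_deriv coord \<gamma> dirac) \<phi>"
    for \<gamma> \<beta>
  have main: "distr_of_fun f \<phi> =
    (\<Sum>\<gamma> | mi_size \<gamma> < K. complex_of_real (1 / mi_fact \<gamma>) * (LINT x|lborel. h \<gamma> x * \<psi> \<gamma> (x, 0))) +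
    (\<Sum>\<gamma> | mi_size \<gamma> = K. complex_of_real (real K / mi_fact \<gamma>) *
       (LINT z|lborel. dil_y.average K (\<lambda>z. complex_of_real (mi_pow (snd z) \<gamma>) * f z) z * \<psi> \<gamma> z))"
    using expansion_snd[OF f \<phi> K0] by (simp only: slice flip: \<psi>_def)
  have F: "complex_of_real (real K / mi_fact \<gamma>) *
       (LINT z|lborel. dil_y.average K (\<lambda>z. complex_of_real (mi_pow (snd z) \<gamma>) * f z) z * \<psi> \<gamma> z) =
      distr_deriv ydir \<gamma> (distr_of_fun (F_rem k \<gamma> f)) \<phi>" if "mi_size \<gamma> = K" for \<gamma>
    unfolding distr_deriv_def distr_of_fun_def F_rem_eq[OF k K_def] that \<psi>_def
    by (simp add: mult.assoc flip: power_mult_distrib)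
  have x: "complex_of_real (1 / mi_fact \<gamma>) * (LINT x|lborel. h \<gamma> x * \<psi> \<gamma> (x, 0)) =
      (\<Sum>\<beta> | mi_size \<beta> + 2 * mi_size \<gamma> \<le> k. A \<gamma> \<beta>) +
      (\<Sum>\<beta> | mi_size \<beta> + 2 * mi_size \<gamma> = k + 1. Rt \<gamma> \<beta>)" if \<gamma>: "mi_size \<gamma> < K" for \<gamma>
  proof -
    \<comment> \<open>Because |\<gamma>| < K and k + 1 = 2K, at least two x-derivatives remain, so
      \<open>expansion_fst\<close> applies.\<close>
    define M where "M = k + 1 - 2 * mi_size \<gamma>"
    have M0: "0 < M" and M: "M + 2 * mi_size \<gamma> = k + 1"
      using \<gamma> k_eq by (auto simp: M_def)
    have \<psi>T: "mi_deriv xdir \<beta> (\<psi> \<gamma>) z = 0" if "z \<notin> T" for \<beta> z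
    proof (rule mi_deriv_eq_0_outside_support)
      have "closure {z. \<psi> \<gamma> z \<noteq> 0} \<subseteq> T"
        by (rule closure_minimal) (use T in \<open>auto simp: \<psi>_def intro: compact_imp_closed\<close>)
      then show "z \<notin> closure {z. \<psi> \<gamma> z \<noteq> 0}"
        using that by auto
    qed
    \<comment> \<open>The sign (-1)^|\<gamma>| occurs in the coefficient and in the tensor product,
      (-1)^M in \<open>R_rem\<close> and in the tensor product; both pairs cancel.\<close>
    have Rt_eq: "complex_of_real (1 / mi_fact \<gamma>) * (complex_of_real (real M / mi_fact \<beta>) *
       (LINT x|lborel. dil_x.average M (\<lambda>x. complex_of_real (mi_pow x \<beta>) * h \<gamma> x) x *
          mi_deriv xdir \<beta> (\<psi> \<gamma>) (x, 0))) = Rt \<gamma> \<beta>" if "mi_size \<beta> = M" for \<beta>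
    proof -
      have "(\<lambda>x. R_rem \<beta> \<gamma> f x * mi_deriv xdir \<beta> (\<psi> \<gamma>) (x, 0)) =
          (\<lambda>x. complex_of_real (real M / mi_fact \<beta> * (- 1) ^ M) *
            (dil_x.average M (\<lambda>x. complex_of_real (mi_pow x \<beta>) * h \<gamma> x) x *
              mi_deriv xdir \<beta> (\<psi> \<gamma>) (x, 0)))"
        unfolding R_rem_eq that h_def by (simp only: mult.assoc)
      then have "(LINT x|lborel. R_rem \<beta> \<gamma> f x * mi_deriv xdir \<beta> (\<psi> \<gamma>) (x, 0)) =
          complex_of_real (real M / mi_fact \<beta> * (- 1) ^ M) *
          (LINT x|lborel. dil_x.average M (\<lambda>x. complex_of_real (mi_pow x \<beta>) * h \<gamma> x) x *
              mi_deriv xdir \<beta> (\<psi> \<gamma>) (x, 0))"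
        by (simp only: integral_mult_right_zero)
      moreover have "((- 1) ^ mi_size \<gamma>) * ((- 1) ^ mi_size \<gamma>) = (1 :: complex)"
        "((- 1) ^ M) * ((- 1) ^ M) = (1 :: complex)"
        by (simp_all flip: power_mult_distrib)
      ultimately show ?thesis
        unfolding Rt_def tensor_remainder[OF sm] \<psi>_def[symmetric] that
        by (simp add: power_add mult_ac)
    qed
    have taylor: "(LINT x|lborel. h \<gamma> x * \<psi> \<gamma> (x, 0)) =
      (\<Sum>\<beta> | mi_size \<beta> < M. complex_of_real (1 / mi_fact \<beta>) * mom \<beta> \<gamma> * mi_deriv xdir \<beta> (\<psi> \<gamma>) 0) +
      (\<Sum>\<beta> | mi_size \<beta> = M. complex_of_real (real M / mi_fact \<beta>) *
       (LINT x|lborel. dil_x.average M (\<lambda>x. complex_of_real (mi_pow x \<beta>) * h \<gamma> x) x *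
          mi_deriv xdir \<beta> (\<psi> \<gamma>) (x, 0)))"
      using expansion_fst[where h = "h \<gamma>", OF sm\<psi> T(1) \<psi>T _ M0] weighted by simp
    have "complex_of_real (1 / mi_fact \<gamma>) * (LINT x|lborel. h \<gamma> x * \<psi> \<gamma> (x, 0)) =
      (\<Sum>\<beta> | mi_size \<beta> < M. A \<gamma> \<beta>) + (\<Sum>\<beta> | mi_size \<beta> = M. Rt \<gamma> \<beta>)"
      unfolding taylor distrib_left sum_distrib_left
      by (intro arg_cong2[where f = "(+)"] sum.cong refl Rt_eq) (auto simp: A_def)
    moreover have "{\<beta> :: 'm \<Rightarrow> nat. mi_size \<beta> < M} = {\<beta>. mi_size \<beta> + 2 * mi_size \<gamma> \<le> k}"
      "{\<beta> :: 'm \<Rightarrow> nat. mi_size \<beta> = M} = {\<beta>. mi_size \<beta> + 2 * mi_size \<gamma> = k + 1}"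
      using M by auto
    ultimately show ?thesis
      by simp
  qed
  \<comment> \<open>Since k < 2K, every pair with |\<beta>| + 2|\<gamma>| \<le> k has |\<gamma>| <
    K, so the iterated sum reaches all of them.\<close>
  have first: "(\<Sum>\<gamma> | mi_size \<gamma> < K. \<Sum>\<beta> | mi_size \<beta> + 2 * mi_size \<gamma> \<le> k. A \<gamma> \<beta>) =
      (\<Sum>(\<beta>, \<gamma>) \<in> {(\<beta> :: 'm \<Rightarrow> nat, \<gamma> :: 'n \<Rightarrow> nat). mi_size \<beta> + 2 * mi_size \<gamma> \<le> k}. A \<gamma> \<beta>)"
  proof -
    have fin: "finite {\<beta> :: 'm \<Rightarrow> nat. mi_size \<beta> + 2 * mi_size \<gamma> \<le> k}" for \<gamma> :: "'n \<Rightarrow> nat"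
      by (rule finite_subset[OF _ finite_mi_size_le[of k]]) auto
    have "(\<Sum>\<gamma> | mi_size \<gamma> < K. \<Sum>\<beta> | mi_size \<beta> + 2 * mi_size \<gamma> \<le> k. A \<gamma> \<beta>) =
        (\<Sum>(\<gamma>, \<beta>) \<in> (SIGMA \<gamma>:{\<gamma>. mi_size \<gamma> < K}. {\<beta>. mi_size \<beta> + 2 * mi_size \<gamma> \<le> k}). A \<gamma> \<beta>)"
      by (rule sum.Sigma) (use fin in auto)
    also have "\<dots> = (\<Sum>(\<beta>, \<gamma>) \<in> {(\<beta>, \<gamma>). mi_size \<beta> + 2 * mi_size \<gamma> \<le> k}. A \<gamma> \<beta>)"
      by (rule sum.reindex_bij_witness[where i = prod.swap and j = prod.swap]) (use k_eq in auto)
    finally show ?thesis .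
  qed
  have A_eq: "complex_of_real ((- 1) ^ (mi_size \<beta> + mi_size \<gamma>) / (mi_fact \<beta> * mi_fact \<gamma>)) * mom \<beta> \<gamma> *
      distr_deriv xdir \<beta> (distr_deriv ydir \<gamma> dirac) \<phi> = A \<gamma> \<beta>" for \<beta> \<gamma>
  proof -
    have "((- 1) ^ (mi_size \<beta> + mi_size \<gamma>)) * ((- 1) ^ (mi_size \<beta> + mi_size \<gamma>)) = (1 :: complex)"
      by (simp flip: power_mult_distrib)
    then show ?thesis
      unfolding distr_deriv_xy_dirac[OF sm] A_def \<psi>_def by (simp add: field_simps)
  qed
  have total: "distr_of_fun f \<phi> =
      (\<Sum>\<gamma> | mi_size \<gamma> < K. \<Sum>\<beta> | mi_size \<beta> + 2 * mi_size \<gamma> \<le> k. A \<gamma> \<beta>) +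
      (\<Sum>\<gamma> | mi_size \<gamma> < K. \<Sum>\<beta> | mi_size \<beta> + 2 * mi_size \<gamma> = k + 1. Rt \<gamma> \<beta>) +
      (\<Sum>\<gamma> | mi_size \<gamma> = K. distr_deriv ydir \<gamma> (distr_of_fun (F_rem k \<gamma> f)) \<phi>)"
    unfolding main sum.distrib[symmetric] using x F by (intro arg_cong2[where f = "(+)"] sum.cong) auto
  have index: "{\<gamma> :: 'n \<Rightarrow> nat. mi_size \<gamma> < K} = {\<gamma>. mi_size \<gamma> \<le> (k - 1) div 2}"
    using k_eq by auto
  show ?thesis
    using total unfolding first unfolding index unfolding A_eq[symmetric] mom_def Rt_def K_def .
qed

theorem lemma3p1:
  fixes f :: "(real ^ 'm::finite) \<times> (real ^ 'n::finite) \<Rightarrow> complex"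
    and k :: nat
  assumes "odd k" and "test_function f"
  shows "(\<forall>\<phi> :: (real ^ 'm) \<times> (real ^ 'n) \<Rightarrow> complex. test_function \<phi> \<longrightarrow>
      distr_of_fun f \<phi> =
        (\<Sum>(\<beta>, \<gamma>) \<in> {(\<beta> :: 'm \<Rightarrow> nat, \<gamma> :: 'n \<Rightarrow> nat). mi_size \<beta> + 2 * mi_size \<gamma> \<le> k}.
           complex_of_real ((- 1) ^ (mi_size \<beta> + mi_size \<gamma>) / (mi_fact \<beta> * mi_fact \<gamma>)) *
           (LINT (x, y)|lborel. f (x, y) * complex_of_real (mi_pow x \<beta> * mi_pow y \<gamma>)) *
           distr_deriv xdir \<beta> (distr_deriv ydir \<gamma> dirac) \<phi>)
      + (\<Sum>\<gamma> \<in> {\<gamma> :: 'n \<Rightarrow> nat. mi_size \<gamma> \<le> (k - 1) div 2}.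
           \<Sum>\<beta> \<in> {\<beta> :: 'm \<Rightarrow> nat. mi_size \<beta> + 2 * mi_size \<gamma> = k + 1}.
             complex_of_real ((- 1) ^ mi_size \<gamma> / mi_fact \<gamma>) *
             distr_tensor (distr_deriv coord \<beta> (distr_of_fun (R_rem \<beta> \<gamma> f)))
                          (distr_deriv coord \<gamma> dirac) \<phi>)
      + (\<Sum>\<gamma> \<in> {\<gamma> :: 'n \<Rightarrow> nat. mi_size \<gamma> = (k + 1) div 2}.
           distr_deriv ydir \<gamma> (distr_of_fun (F_rem k \<gamma> f)) \<phi>))
    \<and> (\<forall>(p :: real) (\<gamma> :: 'n \<Rightarrow> nat).
        1 \<le> p \<and> ereal p < crit_exp CARD('n) \<and> mi_size \<gamma> = (k + 1) div 2 \<longrightarrow>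
        in_Lp p (F_rem k \<gamma> f) \<and>
        Lp_norm p (F_rem k \<gamma> f) \<le>
          dilation_const p \<gamma> *
          Lp_norm p (\<lambda>(x, y). complex_of_real (norm y ^ ((k + 1) div 2)) * f (x, y)))
    \<and> (\<forall>(p :: real) (\<beta> :: 'm \<Rightarrow> nat) (\<gamma> :: 'n \<Rightarrow> nat).
        1 \<le> p \<and> ereal p < crit_exp CARD('m) \<and>
        mi_size \<gamma> \<le> (k - 1) div 2 \<and> mi_size \<beta> + 2 * mi_size \<gamma> = k + 1 \<longrightarrow>
        in_Lp p (R_rem \<beta> \<gamma> f) \<and>
        Lp_norm p (R_rem \<beta> \<gamma> f) \<le>
          dilation_const p \<beta> * mixed_norm p (mi_size \<beta>) (mi_size \<gamma>) f)"
  \<comment> \<open>The index conditions on \<open>\<beta>\<close> and \<open>\<gamma>\<close> force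
    |\<beta>| \<ge> 2, which supplies the positivity required by \<open>R_rem_Lp\<close>.\<close>
  using distr_of_fun_expansion[OF assms] F_rem_Lp[OF assms] R_rem_Lp[OF assms(2)] by auto

end
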